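(* There exist a Carnot group $\mathbb G$ and a $C^{\infty}$ non-characteristic hypersurface $S\subseteq\mathbb G$ with uncountably many pairwise non-isomorphic tangent groups; that is, the family $\{T_p^{\rm I}S\}_{p\in S}$ contains uncountably many pairwise non-isomorphic groups.
   Context: A Carnot group $\mathbb G$ is a simply connected nilpotent Lie group whose Lie algebra has a stratification $\mathfrak g=V_1\oplus\dots\oplus V_s$ with $V_{i+1}=[V_1,V_i]$, $V_s\ne\{0\}$, $[V_1,V_s]=\{0\}$. Let $m=\dim V_1$, $n=\dim\mathfrak g$, and let $(X_1,\dots,X_n)$ be a basis of $\mathfrak g$ adapted to the stratification; $\mathbb G$ is identified with $\mathbb R^n$ via $(x_1,\dots,x_n)\mapsto\exp(\sum x_iX_i)$, and $X_i$ also denotes the corresponding left-invariant vector field. The horizontal bundle is $\mathbb V_1(x)=\mathrm{span}\{X_1(x),\dots,X_m(x)\}$. A $C^\infty$-hypersurface is a nonempty subset $S$ that near each of its points is the zero set of a $C^\infty$ function $f$ with nonvanishing gradient on it; it is non-characteristic if at no $x\in S$ one has $\mathbb V_1(x)\subseteq T_xS$ (usual tangent space). For $p\in S$ and such $f$ near $p$, the tangent group of $S$ at $p$ is the subgroup $T_p^{\rm I}S=\{v\in\mathbb G\equiv\mathbb R^n:\sum_{i=1}^m v_i\,X_if(p)=0\}$ (independent of $f$). *)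

theory Defs
  imports "HOL-Analysis.Analysis" "HOL-Algebra.Group"
begin

text \<open>
  Since the dimension is quantified inside the statement, \<open>\<real>\<^sup>n\<close> is the library's
  \<^const>\<open>Euclidean_space\<close>: sequences \<^typ>\<open>nat \<Rightarrow> real\<close> that vanish at all indices \<open>\<ge> n\<close>.
  Coordinates are numbered from 0, so the basis field \<open>X\<^sub>i\<close> has index \<open>i - 1\<close> here.
\<close>

type_synonym point = "nat \<Rightarrow> real"
type_synonym vfield = "point \<Rightarrow> point"

abbreviation Rn :: "nat \<Rightarrow> point set" where
  "Rn n \<equiv> topspace (Euclidean_space n)"

definition unit_vec :: "nat \<Rightarrow> point" where
  "unit_vec i = (\<lambda>k. if k = i then 1 else 0)"

definition scale_point :: "real \<Rightarrow> point \<Rightarrow> point" where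
  "scale_point c v = (\<lambda>k. c * v k)"

definition lin_span :: "point set \<Rightarrow> point set" where
  "lin_span A = {\<lambda>k. \<Sum>v\<in>T. c v * v k | T c. finite T \<and> T \<subseteq> A}"


section \<open>Smooth functions and vector fields\<close>

definition partial_deriv :: "nat \<Rightarrow> (point \<Rightarrow> real) \<Rightarrow> point \<Rightarrow> real" where
  "partial_deriv i f x = deriv (\<lambda>t. f (x(i := t))) (x i)"

text \<open>Only meaningful for \<open>U\<close> open in \<open>\<real>\<^sup>n\<close>.\<close>

primrec Ck_on :: "nat \<Rightarrow> nat \<Rightarrow> point set \<Rightarrow> (point \<Rightarrow> real) \<Rightarrow> bool" where
  "Ck_on n 0 U f \<longleftrightarrow>
     continuous_map (subtopology (Euclidean_space n) U) euclideanreal f"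
| "Ck_on n (Suc k) U f \<longleftrightarrow>
     continuous_map (subtopology (Euclidean_space n) U) euclideanreal f \<and>
     (\<forall>i<n. (\<forall>x\<in>U. (\<lambda>t. f (x(i := t))) differentiable at (x i)) \<and>
            Ck_on n k U (partial_deriv i f))"

definition smooth_on :: "nat \<Rightarrow> point set \<Rightarrow> (point \<Rightarrow> real) \<Rightarrow> bool" where
  "smooth_on n U f \<longleftrightarrow> (\<forall>k. Ck_on n k U f)"

definition vf_apply :: "nat \<Rightarrow> vfield \<Rightarrow> (point \<Rightarrow> real) \<Rightarrow> point \<Rightarrow> real" where
  "vf_apply n X f p = (\<Sum>k<n. X p k * partial_deriv k f p)"

definition vf_bracket :: "nat \<Rightarrow> vfield \<Rightarrow> vfield \<Rightarrow> vfield" where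
  "vf_bracket n X Y p =
     (\<lambda>k. vf_apply n X (\<lambda>q. Y q k) p - vf_apply n Y (\<lambda>q. X q k) p)"


section \<open>Lie groups in exponential coordinates\<close>

text \<open>Smoothness of the multiplication is smoothness in \<open>2n\<close> variables, the first \<open>n\<close> of which
  are the coordinates of the left factor.\<close>

definition left_half :: "nat \<Rightarrow> point \<Rightarrow> point" where
  "left_half n z = (\<lambda>i. if i < n then z i else 0)"

definition right_half :: "nat \<Rightarrow> point \<Rightarrow> point" where
  "right_half n z = (\<lambda>i. if i < n then z (n + i) else 0)"

definition lie_group_on_Rn :: "nat \<Rightarrow> point monoid \<Rightarrow> bool" where
  "lie_group_on_Rn n G \<longleftrightarrow>
     group G \<and> carrier G = Rn n \<and>
     (\<forall>k<n. smooth_on (2 * n) (Rn (2 * n)) (\<lambda>z. (left_half n z \<otimes>\<^bsub>G\<^esub> right_half n z) k)) \<and>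
     (\<forall>k<n. smooth_on n (Rn n) (\<lambda>x. (inv\<^bsub>G\<^esub> x) k))"

text \<open>The coordinates are exponential when, for each \<open>v\<close>, the one-parameter subgroup with initial
  velocity \<open>v\<close> is \<open>t \<mapsto> t v\<close>; this says \<open>exp (\<Sum>\<^sub>i v\<^sub>i X\<^sub>i) = v\<close>. In particular the identity is the
  origin.\<close>

definition exponential_coordinates :: "nat \<Rightarrow> point monoid \<Rightarrow> bool" where
  "exponential_coordinates n G \<longleftrightarrow>
     (\<forall>v\<in>Rn n. \<forall>s t. scale_point s v \<otimes>\<^bsub>G\<^esub> scale_point t v = scale_point (s + t) v)"

text \<open>The left-invariant field with value \<open>v\<close> at the identity: \<open>t \<mapsto> t v\<close> passes through the identity
  with velocity \<open>v\<close> and is translated to \<open>p\<close>.\<close>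

definition left_inv_field :: "point monoid \<Rightarrow> point \<Rightarrow> vfield" where
  "left_inv_field G v p = (\<lambda>k. deriv (\<lambda>t. (p \<otimes>\<^bsub>G\<^esub> scale_point t v) k) 0)"

abbreviation basis_field :: "point monoid \<Rightarrow> nat \<Rightarrow> vfield" where
  "basis_field G i \<equiv> left_inv_field G (unit_vec i)"

text \<open>The Lie algebra is \<open>\<real>\<^sup>n\<close>, the tangent space at the identity, where \<open>v\<close> stands for the
  left-invariant field with value \<open>v\<close> there.\<close>

definition lie_bracket :: "nat \<Rightarrow> point monoid \<Rightarrow> point \<Rightarrow> point \<Rightarrow> point" where
  "lie_bracket n G u v = vf_bracket n (left_inv_field G u) (left_inv_field G v) \<one>\<^bsub>G\<^esub>"

definition bracket_space :: "nat \<Rightarrow> point monoid \<Rightarrow> point set \<Rightarrow> point set \<Rightarrow> point set" where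
  "bracket_space n G A B = lin_span {lie_bracket n G u v | u v. u \<in> A \<and> v \<in> B}"

primrec lower_central :: "nat \<Rightarrow> point monoid \<Rightarrow> nat \<Rightarrow> point set" where
  "lower_central n G 0 = Rn n"
| "lower_central n G (Suc k) = bracket_space n G (Rn n) (lower_central n G k)"

definition nilpotent_lie :: "nat \<Rightarrow> point monoid \<Rightarrow> bool" where
  "nilpotent_lie n G \<longleftrightarrow> (\<exists>k. lower_central n G k = {\<lambda>_. 0})"


section \<open>Carnot groups\<close>

text \<open>A basis adapted to \<open>V\<^sub>1 \<oplus> \<dots> \<oplus> V\<^sub>s\<close> is recorded by the degrees \<open>w i\<close> of its members:
  \<open>V\<^sub>j\<close> is spanned by the basis vectors of degree \<open>j\<close>, and degrees do not decrease along the basis.\<close>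

definition layer :: "nat \<Rightarrow> (nat \<Rightarrow> nat) \<Rightarrow> nat \<Rightarrow> point set" where
  "layer n w j = lin_span {unit_vec i | i. i < n \<and> w i = j}"

definition adapted_degrees :: "nat \<Rightarrow> nat \<Rightarrow> (nat \<Rightarrow> nat) \<Rightarrow> bool" where
  "adapted_degrees n s w \<longleftrightarrow>
     (\<forall>i<n. 1 \<le> w i \<and> w i \<le> s) \<and> (\<forall>i j. i \<le> j \<and> j < n \<longrightarrow> w i \<le> w j)"

definition stratified :: "nat \<Rightarrow> nat \<Rightarrow> (nat \<Rightarrow> nat) \<Rightarrow> point monoid \<Rightarrow> bool" where
  "stratified n s w G \<longleftrightarrow>
     1 \<le> s \<and> adapted_degrees n s w \<and>
     (\<forall>j. 1 \<le> j \<and> j < s \<longrightarrow>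
        layer n w (Suc j) = bracket_space n G (layer n w 1) (layer n w j)) \<and>
     layer n w s \<noteq> {\<lambda>_. 0} \<and>
     bracket_space n G (layer n w 1) (layer n w s) = {\<lambda>_. 0}"

text \<open>Simple connectedness holds because the underlying manifold is \<open>\<real>\<^sup>n\<close>.\<close>

definition carnot_group :: "nat \<Rightarrow> nat \<Rightarrow> (nat \<Rightarrow> nat) \<Rightarrow> point monoid \<Rightarrow> bool" where
  "carnot_group n s w G \<longleftrightarrow>
     lie_group_on_Rn n G \<and> exponential_coordinates n G \<and>
     nilpotent_lie n G \<and> stratified n s w G"

definition horizontal_dim :: "nat \<Rightarrow> (nat \<Rightarrow> nat) \<Rightarrow> nat" where
  "horizontal_dim n w = card {i. i < n \<and> w i = 1}"

definition horizontal_space :: "nat \<Rightarrow> (nat \<Rightarrow> nat) \<Rightarrow> point monoid \<Rightarrow> point \<Rightarrow> point set" where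
  "horizontal_space n w G p = lin_span {basis_field G i p | i. i < horizontal_dim n w}"


section \<open>Hypersurfaces and tangent groups\<close>

definition defining_near ::
  "nat \<Rightarrow> point set \<Rightarrow> point \<Rightarrow> point set \<Rightarrow> (point \<Rightarrow> real) \<Rightarrow> bool" where
  "defining_near n S p U f \<longleftrightarrow>
     openin (Euclidean_space n) U \<and> p \<in> U \<and> smooth_on n U f \<and>
     S \<inter> U = {x \<in> U. f x = 0} \<and>
     (\<forall>x \<in> S \<inter> U. \<exists>i<n. partial_deriv i f x \<noteq> 0)"

definition smooth_hypersurface :: "nat \<Rightarrow> point set \<Rightarrow> bool" where
  "smooth_hypersurface n S \<longleftrightarrow>
     S \<noteq> {} \<and> S \<subseteq> Rn n \<and> (\<forall>p\<in>S. \<exists>U f. defining_near n S p U f)"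

text \<open>Neither the tangent space nor the tangent group depends on the choice of the defining
  function.\<close>

definition defining_fun :: "nat \<Rightarrow> point set \<Rightarrow> point \<Rightarrow> point \<Rightarrow> real" where
  "defining_fun n S p = (SOME f. \<exists>U. defining_near n S p U f)"

definition tangent_space :: "nat \<Rightarrow> point set \<Rightarrow> point \<Rightarrow> point set" where
  "tangent_space n S p =
     {v \<in> Rn n. (\<Sum>i<n. v i * partial_deriv i (defining_fun n S p) p) = 0}"

definition non_characteristic ::
  "nat \<Rightarrow> (nat \<Rightarrow> nat) \<Rightarrow> point monoid \<Rightarrow> point set \<Rightarrow> bool" where
  "non_characteristic n w G S \<longleftrightarrow>
     \<not> (\<exists>x\<in>S. horizontal_space n w G x \<subseteq> tangent_space n S x)"

definition tangent_group ::
  "nat \<Rightarrow> (nat \<Rightarrow> nat) \<Rightarrow> point monoid \<Rightarrow> point set \<Rightarrow> point \<Rightarrow> point monoid" where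
  "tangent_group n w G S p =
     G\<lparr>carrier := {v \<in> Rn n.
        (\<Sum>i<horizontal_dim n w. v i * vf_apply n (basis_field G i) (defining_fun n S p) p) = 0}\<rparr>"

end

theory Submission
  imports Defs
begin

text \<open>
  The group has step 2, with horizontal coordinates \<open>x\<^sub>0, \<dots>, x\<^sub>3, y\<^sub>0, \<dots>,
  y\<^sub>3, a\<close> (in this order) and centre \<open>\<real>\<^sup>2\<close>. Its nonzero brackets are
  \<open>[x\<^sub>i, y\<^sub>i] = z\<^sub>i\<close> for \<open>i \<le> 3\<close> and \<open>[a, y\<^sub>3] =
  z\<^sub>1\<close>, where \<open>z\<^sub>0 = z\<^sub>3 = (1,0)\<close>, \<open>z\<^sub>1 = (0,1)\<close>,
  \<open>z\<^sub>2 = (1,1)\<close>. The hypersurface \<open>a = x\<^sub>3\<^sup>2 / 2\<close> has the tangent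
  group \<open>a = t x\<^sub>3\<close> at its points with \<open>x\<^sub>3 = t\<close>, and in this subgroup
  \<open>[x\<^sub>3, y\<^sub>3]\<close> becomes \<open>(1,t)\<close>. The four lines in the centre spanned by
  \<open>(1,0), (0,1), (1,1), (1,t)\<close> are the sets \<open>[g, H]\<close>, for \<open>g\<close> in this
  subgroup \<open>H\<close>, that are neither trivial nor the whole centre, so an abstract isomorphism
  permutes them. On each line it is real-linear: the Heisenberg relation on \<open>x\<^sub>i,
  y\<^sub>i\<close> makes it, up to a factor, a ring endomorphism of \<open>\<real>\<close>. Hence it is
  linear on the centre and preserves the cross ratio of the lines up to a permutation; for \<open>t >
  2\<close> this determines \<open>t\<close>.
\<close>

section \<open>Polynomial maps\<close>

text \<open>All smoothness below reduces to polynomial functions. They are closed under partial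
  derivatives, so one induction on the order gives every \<open>Ck_on\<close>.\<close>

inductive poly_map :: "(point \<Rightarrow> real) \<Rightarrow> bool" where
  const: "poly_map (\<lambda>x. c)"
| coord: "poly_map (\<lambda>x. x k)"
| add: "poly_map f \<Longrightarrow> poly_map g \<Longrightarrow> poly_map (\<lambda>x. f x + g x)"
| mult: "poly_map f \<Longrightarrow> poly_map g \<Longrightarrow> poly_map (\<lambda>x. f x * g x)"

lemma poly_map_diff:
  assumes "poly_map f" "poly_map g"
  shows "poly_map (\<lambda>x. f x - g x)"
proof -
  have "poly_map (\<lambda>x. f x + (-1) * g x)"
    by (intro poly_map.intros assms)
  then show ?thesis by simp
qed

lemma poly_map_continuous:
  "poly_map f \<Longrightarrow> continuous_map (subtopology (Euclidean_space n) U) euclideanreal f"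
proof (induction rule: poly_map.induct)
  case (coord k)
  show ?case
    unfolding Euclidean_space_def
    by (intro continuous_map_from_subtopology continuous_map_product_projection) auto
qed (auto intro: continuous_map_add continuous_map_real_mult)

lemma poly_map_has_partial_deriv:
  "poly_map f \<Longrightarrow>
     \<exists>g. poly_map g \<and> (\<forall>x. ((\<lambda>t. f (x(i := t))) has_real_derivative g x) (at (x i)))"
proof (induction rule: poly_map.induct)
  case (const c)
  show ?case by (intro exI[of _ "\<lambda>x. 0"]) (auto intro: poly_map.intros)
next
  case (coord k)
  show ?case
    by (intro exI[of _ "\<lambda>x. if k = i then 1 else 0"])
       (cases "k = i"; auto intro: poly_map.intros)
next
  case (add f g)
  then obtain f' g' where
    "poly_map f'" "\<And>x. ((\<lambda>t. f (x(i := t))) has_real_derivative f' x) (at (x i))"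
    "poly_map g'" "\<And>x. ((\<lambda>t. g (x(i := t))) has_real_derivative g' x) (at (x i))" by blast
  note d = this
  have "((\<lambda>t. f (x(i := t)) + g (x(i := t))) has_real_derivative f' x + g' x) (at (x i))" for x
    using DERIV_add[OF d(2)[of x] d(4)[of x]] .
  moreover have "poly_map (\<lambda>x. f' x + g' x)"
    using d by (intro poly_map.intros) auto
  ultimately show ?case by blast
next
  case (mult f g)
  then obtain f' g' where
    "poly_map f'" "\<And>x. ((\<lambda>t. f (x(i := t))) has_real_derivative f' x) (at (x i))"
    "poly_map g'" "\<And>x. ((\<lambda>t. g (x(i := t))) has_real_derivative g' x) (at (x i))" by blast
  note d = this
  have "((\<lambda>t. f (x(i := t)) * g (x(i := t))) has_real_derivative f' x * g x + g' x * f x) (at (x i))" for x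
    using DERIV_mult[OF d(2)[of x] d(4)[of x]] by simp
  moreover have "poly_map (\<lambda>x. f' x * g x + g' x * f x)"
    using d mult by (intro poly_map.intros) auto
  ultimately show ?case by blast
qed

lemma poly_map_smooth:
  assumes "poly_map f"
  shows "smooth_on n U f"
proof -
  have "Ck_on n k U f" for k
    using assms
  proof (induction k arbitrary: f)
    case 0
    then show ?case by (simp add: poly_map_continuous)
  next
    case (Suc k)
    have "(\<forall>x\<in>U. (\<lambda>t. f (x(i := t))) differentiable at (x i)) \<and> Ck_on n k U (partial_deriv i f)" for i
    proof -
      obtain g where g: "poly_map g"
        "\<And>x. ((\<lambda>t. f (x(i := t))) has_real_derivative g x) (at (x i))"
        using poly_map_has_partial_deriv[OF Suc.prems, of i] by blast
      have "partial_deriv i f = g"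
        unfolding partial_deriv_def using g(2) by (auto intro!: ext DERIV_imp_deriv)
      with Suc.IH[OF g(1)] g(2) show ?thesis
        using real_differentiable_def by auto
    qed
    then show ?case using Suc.prems by (simp add: poly_map_continuous)
  qed
  then show ?thesis by (simp add: smooth_on_def)
qed

section \<open>Points of the coordinate space and spans of unit vectors\<close>

lemma mem_Rn: "x \<in> Rn n \<longleftrightarrow> (\<forall>k\<ge>n. x k = 0)"
  by (auto simp: topspace_Euclidean_space)

text \<open>A group inverse is specified only on the carrier, so its smoothness is checked on a
  function that agrees with it there. Altering a coordinate \<open>i < n\<close> stays inside
  \<open>Rn n\<close>, so the one-variable slices of \<open>f\<close> and \<open>g\<close> coincide
  as whole functions.\<close>

lemma smooth_on_Rn_cong:
  assumes "\<And>x. x \<in> Rn n \<Longrightarrow> f x = g x"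
  shows "smooth_on n (Rn n) f \<longleftrightarrow> smooth_on n (Rn n) g"
proof -
  have "Ck_on n k (Rn n) f \<longleftrightarrow> Ck_on n k (Rn n) g" for k
    using assms
  proof (induction k arbitrary: f g)
    case 0
    then show ?case by (auto intro: continuous_map_eq)
  next
    case (Suc k)
    have c: "continuous_map (subtopology (Euclidean_space n) (Rn n)) euclideanreal f \<longleftrightarrow>
          continuous_map (subtopology (Euclidean_space n) (Rn n)) euclideanreal g"
      using Suc.prems by (auto intro: continuous_map_eq)
    have e: "(\<lambda>t. f (x(i := t))) = (\<lambda>t. g (x(i := t)))" if "x \<in> Rn n" "i < n" for x i
      using that by (intro ext Suc.prems) (auto simp: mem_Rn)
    have "Ck_on n k (Rn n) (partial_deriv i f) \<longleftrightarrow> Ck_on n k (Rn n) (partial_deriv i g)"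
      if "i < n" for i
      by (rule Suc.IH) (use e that in \<open>auto simp: partial_deriv_def\<close>)
    with c e show ?case by auto
  qed
  then show ?thesis by (simp add: smooth_on_def)
qed

lemma lin_span_supported:
  assumes "finite I"
  shows "lin_span (unit_vec ` I) = {v. \<forall>k. k \<notin> I \<longrightarrow> v k = 0}"
proof (intro subset_antisym subsetI)
  fix v assume "v \<in> lin_span (unit_vec ` I)"
  then show "v \<in> {v. \<forall>k. k \<notin> I \<longrightarrow> v k = 0}"
    by (auto simp: lin_span_def unit_vec_def intro!: sum.neutral)
next
  fix v :: point assume v: "v \<in> {v. \<forall>k. k \<notin> I \<longrightarrow> v k = 0}"
  have inj: "inj_on unit_vec I"
    by (auto simp: inj_on_def unit_vec_def fun_eq_iff split: if_splits)
  \<comment> \<open>\<open>lin_span\<close> indexes coefficients by vectors, so the coordinate that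
    belongs to a unit vector is recovered through \<open>inv_into\<close>.\<close>
  have "v = (\<lambda>k. \<Sum>u\<in>unit_vec ` I. v (inv_into I unit_vec u) * u k)"
  proof
    fix k
    have "(\<Sum>u\<in>unit_vec ` I. v (inv_into I unit_vec u) * u k) = (\<Sum>i\<in>I. v i * unit_vec i k)"
      by (simp add: sum.reindex[OF inj] inj)
    also have "\<dots> = (\<Sum>i\<in>I. if i = k then v i else 0)"
      by (intro sum.cong) (auto simp: unit_vec_def)
    also have "\<dots> = v k" using v assms by simp
    finally show "v k = (\<Sum>u\<in>unit_vec ` I. v (inv_into I unit_vec u) * u k)" ..
  qed
  then show "v \<in> lin_span (unit_vec ` I)"
    unfolding lin_span_def using assms
    by (intro CollectI exI[of _ "unit_vec ` I"] exI[of _ "\<lambda>u. v (inv_into I unit_vec u)"]) auto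
qed

lemma lin_span_mono: "A \<subseteq> B \<Longrightarrow> lin_span A \<subseteq> lin_span B"
  unfolding lin_span_def by blast

lemma lin_span_vanishing:
  assumes "\<And>v. v \<in> A \<Longrightarrow> v k = 0" "x \<in> lin_span A"
  shows "x k = 0"
  using assms by (auto simp: lin_span_def intro!: sum.neutral)

lemma lin_span_trivial:
  assumes "A \<subseteq> {\<lambda>_. 0}"
  shows "lin_span A = {\<lambda>_. 0}"
proof -
  have "x = (\<lambda>_. 0)" if "x \<in> lin_span A" for x
    using assms by (auto intro: lin_span_vanishing[OF _ that])
  moreover have "(\<lambda>_. 0) \<in> lin_span A"
    unfolding lin_span_def by (intro CollectI exI[of _ "{}"]) auto
  ultimately show ?thesis by blast
qed

lemma layer_eq: "layer n w j = {v. \<forall>k. v k \<noteq> 0 \<longrightarrow> k < n \<and> w k = j}"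
proof -
  have "{unit_vec i | i. i < n \<and> w i = j} = unit_vec ` {i. i < n \<and> w i = j}" by auto
  then have "layer n w j = lin_span (unit_vec ` {i. i < n \<and> w i = j})" by (simp add: layer_def)
  also have "\<dots> = {v. \<forall>k. v k \<noteq> 0 \<longrightarrow> k < n \<and> w k = j}"
    by (subst lin_span_supported) auto
  finally show ?thesis .
qed

section \<open>Carnot groups of step 2\<close>

text \<open>This is the Baker-Campbell-Hausdorff product: in step 2 the series stops after half the
  bracket \<open>B\<close>, and the coordinates are exponential.\<close>

definition step2_group :: "nat \<Rightarrow> (point \<Rightarrow> point \<Rightarrow> point) \<Rightarrow> point monoid" where
  "step2_group n B =
     \<lparr>carrier = Rn n, mult = (\<lambda>x y k. x k + y k + B x y k / 2), one = (\<lambda>_. 0)\<rparr>"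

lemma step2_group_simps [simp]:
  "carrier (step2_group n B) = Rn n"
  "x \<otimes>\<^bsub>step2_group n B\<^esub> y = (\<lambda>k. x k + y k + B x y k / 2)"
  "\<one>\<^bsub>step2_group n B\<^esub> = (\<lambda>_. 0)"
  by (simp_all add: step2_group_def)

text \<open>Coordinates below \<open>m\<close> form the first layer, those from \<open>m\<close> to
  \<open>n - 1\<close> the second. \<open>horizontal\<close>, together with \<open>skew\<close>,
  makes the second layer central. \<open>generating\<close> asks for each vertical unit vector as a
  single bracket of horizontal vectors, which yields \<open>[V_1, V_1] = V_2\<close> at
  once.\<close>

locale step2_bracket =
  fixes n m :: nat and B :: "point \<Rightarrow> point \<Rightarrow> point"
  assumes m_less: "m < n"
    and vertical: "k < m \<or> n \<le> k \<Longrightarrow> B x y k = 0"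
    and horizontal: "(\<And>k. k < m \<Longrightarrow> x k = 0) \<Longrightarrow> B x y k = 0"
    and add_left: "B (\<lambda>k. x k + x' k) y k = B x y k + B x' y k"
    and scale_left: "B (scale_point c x) y k = c * B x y k"
    and skew: "B y x k = - B x y k"
    and poly: "poly_map (\<lambda>z. B (left_half n z) (right_half n z) k)"
    and generating: "m \<le> k \<Longrightarrow> k < n \<Longrightarrow>
      \<exists>u v. (\<forall>i\<ge>m. u i = 0 \<and> v i = 0) \<and> B u v = unit_vec k"
begin

abbreviation "G \<equiv> step2_group n B"
abbreviation "degrees \<equiv> \<lambda>i::nat. if i < m then 1 else 2 :: nat"

lemma scale_right: "B y (scale_point c x) k = c * B y x k"
  using scale_left[of c x y k] skew[of y] by simp

lemma horizontal': "(\<And>k. k < m \<Longrightarrow> x k = 0) \<Longrightarrow> B y x k = 0"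
  using horizontal[of x y k] skew[of y x k] by simp

lemma zero_left [simp]: "B (\<lambda>_. 0) y k = 0"
  by (rule horizontal) simp

lemma self [simp]: "B x x k = 0"
  using skew[of x x k] by simp

text \<open>The term \<open>B x y\<close> is vertical and so invisible to a further bracket;
  associativity of the product rests on this.\<close>

lemma add3_left: "B (\<lambda>k. x k + y k + B x y k / 2) z k = B x z k + B y z k"
  using add_left[of "\<lambda>k. x k + y k" "\<lambda>k. B x y k / 2" z k] add_left[of x y z k]
    horizontal[of "\<lambda>k. B x y k / 2" z k] vertical by simp

lemma add3_right: "B z (\<lambda>k. x k + y k + B x y k / 2) k = B z x k + B z y k"
  using add3_left[of x y z k] skew[of z] by simp

lemma neg_left: "B (\<lambda>k. - x k) y k = - B x y k"
  using scale_left[of "-1" x y k] by (simp add: scale_point_def)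

lemma group: "group G"
proof (rule groupI)
  fix x assume "x \<in> carrier G"
  then show "\<exists>y\<in>carrier G. y \<otimes>\<^bsub>G\<^esub> x = \<one>\<^bsub>G\<^esub>"
    by (intro bexI[of _ "\<lambda>k. - x k"]) (auto simp: neg_left mem_Rn)
qed (auto simp: mem_Rn vertical add3_left add3_right fun_eq_iff add_divide_distrib)

lemma inv_eq:
  assumes "x \<in> Rn n"
  shows "inv\<^bsub>G\<^esub> x = (\<lambda>k. - x k)"
  using assms
  by (intro group.inv_equality group) (auto simp: neg_left mem_Rn)

lemma lie_group: "lie_group_on_Rn n G"
  unfolding lie_group_on_Rn_def
proof (intro conjI allI impI)
  fix k assume "k < n"
  have "poly_map (\<lambda>z. (left_half n z k + right_half n z k) + (1/2) * B (left_half n z) (right_half n z) k)"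
    using \<open>k < n\<close> unfolding left_half_def right_half_def
    by (intro poly_map.add poly_map.mult poly_map.const poly[unfolded left_half_def right_half_def])
       (auto intro: poly_map.intros)
  then show "smooth_on (2 * n) (Rn (2 * n)) (\<lambda>z. (left_half n z \<otimes>\<^bsub>G\<^esub> right_half n z) k)"
    by (intro poly_map_smooth) simp
  have "smooth_on n (Rn n) (\<lambda>x. (-1) * x k)"
    by (intro poly_map_smooth poly_map.intros)
  then show "smooth_on n (Rn n) (\<lambda>x. (inv\<^bsub>G\<^esub> x) k)"
    by (subst smooth_on_Rn_cong[where g = "\<lambda>x. (-1) * x k"]) (auto simp: inv_eq)
qed (auto simp: group)

lemma exponential: "exponential_coordinates n G"
proof -
  have "B (scale_point s v) (scale_point t v) k = 0" for s t v k
    by (simp add: scale_left scale_right)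
  then show ?thesis
    by (auto simp: exponential_coordinates_def scale_point_def fun_eq_iff algebra_simps)
qed

lemma left_inv_field_eq: "left_inv_field G v p = (\<lambda>k. v k + B p v k / 2)"
proof
  fix k
  have "((\<lambda>t. p k + t * v k + t * B p v k / 2) has_real_derivative v k + B p v k / 2) (at 0)"
    by (auto intro!: derivative_eq_intros)
  then show "left_inv_field G v p k = v k + B p v k / 2"
    unfolding left_inv_field_def
    by (auto intro!: DERIV_imp_deriv simp: scale_right) (simp add: scale_point_def)
qed

lemma sum_unit_left:
  assumes "\<And>k. k \<ge> N \<Longrightarrow> u k = 0"
  shows "(\<Sum>i<N. u i * B (unit_vec i) v k) = B u v k"
  using assms
proof (induction N arbitrary: u)
  case 0
  then have "u = (\<lambda>_. 0)" by auto
  then show ?case by simp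
next
  case (Suc N)
  let ?u = "u(N := 0)"
  have u: "u = (\<lambda>k. ?u k + scale_point (u N) (unit_vec N) k)"
    by (auto simp: scale_point_def unit_vec_def)
  have "B u v k = B ?u v k + u N * B (unit_vec N) v k"
    by (subst u) (simp only: add_left scale_left)
  moreover have "(\<Sum>i<N. ?u i * B (unit_vec i) v k) = B ?u v k"
    using Suc.prems by (intro Suc.IH) (auto simp: Suc_le_eq)
  ultimately show ?case by simp
qed

text \<open>The left-invariant field of \<open>v\<close> is affine in the base point
  \<open>q\<close> with linear part \<open>B q v / 2\<close>, so its derivatives at the origin are
  read off. The contributions \<open>B u v / 2\<close> and \<open>- B v u / 2\<close> add up to
  \<open>B u v\<close> by skewness.\<close>

lemma lie_bracket_eq:
  assumes "u \<in> Rn n" "v \<in> Rn n"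
  shows "lie_bracket n G u v = B u v"
proof -
  have d: "partial_deriv i (\<lambda>q. v k + B q v k / 2) (\<lambda>_. 0) = B (unit_vec i) v k / 2" for i v k
  proof -
    have "(\<lambda>_. 0)(i := t) = scale_point t (unit_vec i)" for t
      by (auto simp: scale_point_def unit_vec_def)
    then have "partial_deriv i (\<lambda>q. v k + B q v k / 2) (\<lambda>_. 0) =
        deriv (\<lambda>t. v k + t * B (unit_vec i) v k / 2) 0"
      by (simp only: partial_deriv_def scale_left)
    also have "\<dots> = B (unit_vec i) v k / 2"
      by (rule DERIV_imp_deriv) (auto intro!: derivative_eq_intros)
    finally show ?thesis .
  qed
  have e: "(\<Sum>i<n. u i * (B (unit_vec i) v k / 2)) = B u v k / 2" if "u \<in> Rn n" for u v k
    using sum_unit_left[of n u v k] that by (simp add: mem_Rn flip: sum_divide_distrib)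
  show ?thesis
  proof
    fix k
    have "lie_bracket n G u v k = B u v k / 2 - B v u k / 2"
      by (simp only: lie_bracket_def vf_bracket_def vf_apply_def left_inv_field_eq d step2_group_simps
          zero_left div_0 add_0_right e assms)
    then show "lie_bracket n G u v k = B u v k" using skew[of v u k] by simp
  qed
qed

lemma bracket_space_trivial:
  assumes "C \<subseteq> Rn n" "D \<subseteq> Rn n" "\<And>v k. v \<in> D \<Longrightarrow> k < m \<Longrightarrow> v k = 0"
  shows "bracket_space n G C D = {\<lambda>_. 0}"
  unfolding bracket_space_def
proof (rule lin_span_trivial, clarsimp)
  fix u v assume "u \<in> C" "v \<in> D"
  with assms have "lie_bracket n G u v = B u v" by (intro lie_bracket_eq) auto
  also have "\<dots> = (\<lambda>_. 0)" using assms(3)[OF \<open>v \<in> D\<close>] by (auto intro: horizontal')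
  finally show "lie_bracket n G u v = (\<lambda>_. 0)" .
qed

lemma nilpotent: "nilpotent_lie n G"
proof -
  have v: "v k = 0" if "v \<in> lower_central n G 1" "k < m \<or> n \<le> k" for v k
    using that(1) unfolding lower_central.simps bracket_space_def One_nat_def
    by (rule lin_span_vanishing[rotated]) (use that(2) in \<open>auto simp: lie_bracket_eq vertical\<close>)
  have "lower_central n G (Suc 1) = {\<lambda>_. 0}"
    unfolding lower_central.simps(2)[of n G 1]
    by (rule bracket_space_trivial) (use v in \<open>auto simp: mem_Rn\<close>)
  then show ?thesis unfolding nilpotent_lie_def by blast
qed

lemma stratified: "stratified n 2 degrees G"
proof -
  have l1: "layer n degrees 1 = {v. \<forall>k\<ge>m. v k = 0}"
  proof -
    have "(v k \<noteq> 0 \<longrightarrow> k < n \<and> degrees k = 1) \<longleftrightarrow> (k \<ge> m \<longrightarrow> v k = 0)" for v :: point and k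
      using m_less by (cases "v k = 0") auto
    then show ?thesis by (simp only: layer_eq)
  qed
  have l2: "layer n degrees 2 = {v. \<forall>k. k < m \<or> n \<le> k \<longrightarrow> v k = 0}"
  proof -
    have "(v k \<noteq> 0 \<longrightarrow> k < n \<and> degrees k = 2) \<longleftrightarrow> (k < m \<or> n \<le> k \<longrightarrow> v k = 0)" for v :: point and k
      by (cases "v k = 0") auto
    then show ?thesis by (simp only: layer_eq)
  qed
  have "layer n degrees 2 \<subseteq> bracket_space n G (layer n degrees 1) (layer n degrees 1)"
    unfolding layer_def[of n degrees 2] bracket_space_def
  proof (rule lin_span_mono, clarify)
    fix k assume "k < n" "degrees k = 2"
    then have "m \<le> k" by (simp split: if_splits)
    with \<open>k < n\<close> obtain u v where "\<forall>i\<ge>m. u i = 0 \<and> v i = 0" "B u v = unit_vec k"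
      using generating by blast
    then show "\<exists>u v. unit_vec k = lie_bracket n G u v \<and> u \<in> layer n degrees 1 \<and> v \<in> layer n degrees 1"
      using m_less unfolding l1 by (intro exI[of _ u] exI[of _ v]) (auto simp: lie_bracket_eq mem_Rn)
  qed
  moreover have "bracket_space n G (layer n degrees 1) (layer n degrees 1) \<subseteq> layer n degrees 2"
  proof
    fix v assume v: "v \<in> bracket_space n G (layer n degrees 1) (layer n degrees 1)"
    have "v k = 0" if k: "k < m \<or> n \<le> k" for k
    proof (rule lin_span_vanishing[OF _ v[unfolded bracket_space_def]])
      fix x assume "x \<in> {lie_bracket n G u v | u v. u \<in> layer n degrees 1 \<and> v \<in> layer n degrees 1}"
      then obtain u v where "x = lie_bracket n G u v" "u \<in> Rn n" "v \<in> Rn n"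
        using m_less unfolding l1 by (force simp: mem_Rn)
      then show "x k = 0" using vertical k by (simp add: lie_bracket_eq)
    qed
    then show "v \<in> layer n degrees 2" unfolding l2 by simp
  qed
  ultimately have l12: "layer n degrees 2 = bracket_space n G (layer n degrees 1) (layer n degrees 1)"
    by blast
  have "layer n degrees (Suc j) = bracket_space n G (layer n degrees 1) (layer n degrees j)"
    if "1 \<le> j" "j < 2" for j
  proof -
    have "j = 1" using that by simp
    with l12 show ?thesis by (simp add: numeral_2_eq_2)
  qed
  moreover have "layer n degrees 2 \<noteq> {\<lambda>_. 0}"
  proof -
    have "unit_vec m \<in> layer n degrees 2" "unit_vec m \<noteq> (\<lambda>_. 0)"
      using m_less by (auto simp: l2 unit_vec_def fun_eq_iff)
    then show ?thesis by blast
  qed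
  moreover have "bracket_space n G (layer n degrees 1) (layer n degrees 2) = {\<lambda>_. 0}"
    unfolding l1 l2 by (rule bracket_space_trivial) (use m_less in \<open>auto simp: mem_Rn\<close>)
  ultimately show ?thesis
    by (auto simp: stratified_def adapted_degrees_def)
qed

lemma carnot: "carnot_group n 2 degrees G"
  by (simp add: carnot_group_def lie_group exponential nilpotent stratified)

lemma horizontal_dim: "horizontal_dim n degrees = m"
proof -
  have "{i. i < n \<and> degrees i = 1} = {..<m}" using m_less by (auto split: if_splits)
  then show ?thesis by (simp add: horizontal_dim_def)
qed

end

section \<open>Four lines in the plane\<close>

text \<open>Such a map fixes the rationals and sends squares to squares, so it is monotone; density
  of the rationals does the rest.\<close>

lemma mult_additive_id:
  fixes f :: "real \<Rightarrow> real"
  assumes add: "\<And>x y. f (x + y) = f x + f y" and mult: "\<And>x y. f (x * y) = f x * f y"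
    and one: "f 1 = 1"
  shows "f x = x"
proof -
  have f0: "f 0 = 0" using add[of 0 0] by simp
  have neg: "f (- x) = - f x" for x using add[of x "- x"] f0 by simp
  have diff: "f (x - y) = f x - f y" for x y using add[of x "- y"] neg by simp
  have nat: "f (of_nat n) = of_nat n" for n
    by (induction n) (auto simp: f0 add one)
  have int: "f (of_int k) = of_int k" for k
    by (cases k rule: int_cases2) (simp_all add: nat neg)
  have rat: "f q = q" if "q \<in> \<rat>" for q
  proof -
    obtain a b :: int where ab: "b > 0" "q = of_int a / of_int b"
      using \<open>q \<in> \<rat>\<close> by (auto elim: Rats_cases')
    then have "of_int b * q = of_int a" by simp
    then have "of_int b * f q = of_int a" using mult[of "of_int b" q] by (simp add: int)
    then have "of_int b * f q = of_int b * q" using \<open>of_int b * q = of_int a\<close> by simp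
    then show ?thesis using ab(1) by simp
  qed
  have nonneg: "f x \<ge> 0" if "x \<ge> 0" for x
    using mult[of "sqrt x" "sqrt x"] that by simp
  have mono: "f x \<le> f y" if "x \<le> y" for x y
    using nonneg[of "y - x"] that by (simp add: diff)
  show ?thesis
  proof (rule antisym; rule ccontr)
    assume "\<not> f x \<le> x"
    then obtain q where "q \<in> \<rat>" "x < q" "q < f x" using Rats_dense_in_real[of x "f x"] by auto
    with mono[of x q] rat show False by auto
  next
    assume "\<not> x \<le> f x"
    then obtain q where "q \<in> \<rat>" "f x < q" "q < x" using Rats_dense_in_real[of "f x" x] by auto
    with mono[of q x] rat show False by auto
  qed
qed

abbreviation det2 :: "real \<times> real \<Rightarrow> real \<times> real \<Rightarrow> real" where
  "det2 u v \<equiv> fst u * snd v - snd u * fst v"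

text \<open>The area identity makes \<open>h (r, 0)\<close> and \<open>h (1, 0)\<close> have
  determinant \<open>\<alpha> 0 = 0\<close>. The Pluecker relation among the images of
  \<open>(r, 0)\<close>, \<open>(1, 0)\<close>, \<open>(0, s)\<close>, \<open>(0, 1)\<close> then
  becomes multiplicativity of \<open>\<alpha>\<close> divided by \<open>\<alpha> 1\<close>, which is
  therefore a ring endomorphism of the reals.\<close>

lemma additive_similitude_linear:
  assumes add: "\<And>x y. \<alpha> (x + y) = \<alpha> x + \<alpha> y" and ne: "\<alpha> 1 \<noteq> 0"
    and h: "\<And>u v. \<alpha> (det2 u v) = det2 (h u) (h v)"
  shows "\<alpha> s = \<alpha> 1 * s"
proof -
  have a0: "\<alpha> 0 = 0" using add[of 0 0] by simp
  have mult: "\<alpha> (r * s) * \<alpha> 1 = \<alpha> r * \<alpha> s" for r s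
  proof -
    have "\<alpha> (r * s) = det2 (h (r, 0)) (h (0, s))" "\<alpha> 1 = det2 (h (1, 0)) (h (0, 1))"
      "\<alpha> r = det2 (h (r, 0)) (h (0, 1))" "\<alpha> s = det2 (h (1, 0)) (h (0, s))"
      "det2 (h (r, 0)) (h (1, 0)) = 0"
      using h[of "(r, 0)" "(0, s)"] h[of "(1, 0)" "(0, 1)"] h[of "(r, 0)" "(0, 1)"]
        h[of "(1, 0)" "(0, s)"] h[of "(r, 0)" "(1, 0)"] a0 by simp_all
    then show ?thesis by algebra
  qed
  have "\<alpha> s / \<alpha> 1 = s"
  proof (rule mult_additive_id[of "\<lambda>s. \<alpha> s / \<alpha> 1"])
    fix x y show "\<alpha> (x * y) / \<alpha> 1 = \<alpha> x / \<alpha> 1 * (\<alpha> y / \<alpha> 1)"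
      using mult[of x y] ne by (simp add: field_simps)
  qed (auto simp: add add_divide_distrib ne)
  then show ?thesis using ne by (simp add: field_simps)
qed

definition \<zeta> :: "real \<Rightarrow> nat \<Rightarrow> real \<times> real" where
  "\<zeta> t i = (if i = 0 then (1, 0) else if i = 1 then (0, 1) else if i = 2 then (1, 1) else (1, t))"

lemma less_4_cases: "(i::nat) < 4 \<Longrightarrow> i = 0 \<or> i = 1 \<or> i = 2 \<or> i = 3"
  by auto

lemma det_\<zeta>_nonzero:
  assumes "t > 2" "i < 4" "j < 4" "i \<noteq> j"
  shows "det2 (\<zeta> t i) (\<zeta> t j) \<noteq> 0"
  using assms(1,4) less_4_cases[OF assms(2)] less_4_cases[OF assms(3)]
  by (elim disjE) (simp_all add: \<zeta>_def)

text \<open>The equation says that the lines, taken in the order \<open>a, b, c, d\<close>, have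
  cross ratio \<open>s\<close>. Over all orders the cross ratio takes the six values t, 1/t, 1-t,
  1/(1-t), t/(t-1), (t-1)/t, of which only the first exceeds 2 when t > 2.\<close>

lemma cross_ratio_rigid:
  fixes s t :: real
  assumes gt: "s > 2" "t > 2"
    and lt: "a < 4" "b < 4" "c < 4" "d < 4"
    and ne: "a \<noteq> b" "a \<noteq> c" "a \<noteq> d" "b \<noteq> c" "b \<noteq> d" "c \<noteq> d"
    and eq: "det2 (\<zeta> t b) (\<zeta> t c) * det2 (\<zeta> t a) (\<zeta> t d) =
      s * (det2 (\<zeta> t b) (\<zeta> t d) * det2 (\<zeta> t a) (\<zeta> t c))"
  shows "s = t"
proof -
  \<comment> \<open>The one nonlinear fact required: with \<open>s * t\<close> as an atom, each of
    the 24 orders is settled by linear arithmetic. It excludes for instance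
    \<open>s * t = s + t\<close>, the case s = t/(t-1).\<close>
  have "(s - 2) * (t - 2) > 0" using gt by simp
  then have st: "s * t > 2 * s + 2 * t - 4" by (simp add: algebra_simps)
  have z: "\<zeta> t 0 = (1, 0)" "\<zeta> t (Suc 0) = (0, 1)" "\<zeta> t 2 = (1, 1)" "\<zeta> t 3 = (1, t)"
    by (simp_all add: \<zeta>_def)
  show ?thesis
    using ne eq less_4_cases[OF lt(1)] less_4_cases[OF lt(2)] less_4_cases[OF lt(3)] less_4_cases[OF lt(4)]
    by (elim disjE; hypsubst) (use st gt in \<open>simp_all add: z algebra_simps\<close>)
qed

section \<open>The brackets of the tangent groups\<close>

definition coord_pair :: "nat \<Rightarrow> point \<Rightarrow> real \<times> real" where
  "coord_pair i p = (p i, p (4 + i))"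

text \<open>The bracket of \<open>hyperplane t\<close>, with the centre read as a plane: the direct
  sum of four Heisenberg brackets, each pushed onto its own line.\<close>

definition center_bracket :: "real \<Rightarrow> point \<Rightarrow> point \<Rightarrow> real \<times> real" where
  "center_bracket t p q = (\<Sum>i<4. det2 (coord_pair i p) (coord_pair i q) *\<^sub>R \<zeta> t i)"

definition hyperplane :: "real \<Rightarrow> point set" where
  "hyperplane t = {p \<in> Rn 11. p 8 = t * p 3}"

definition line :: "real \<Rightarrow> nat \<Rightarrow> (real \<times> real) set" where
  "line t i = range (\<lambda>r. r *\<^sub>R \<zeta> t i)"

lemma \<zeta>_nonzero: "\<zeta> t i \<noteq> 0"
  by (simp add: \<zeta>_def zero_prod_def)

lemma \<zeta>_notin_line:
  assumes "t > 2" "i < 4" "j < 4" "i \<noteq> j"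
  shows "\<zeta> t j \<notin> line t i"
  using det_\<zeta>_nonzero[OF assms] by (auto simp: line_def)

lemma line_ne_UNIV:
  assumes "t > 2" "i < 4"
  shows "line t i \<noteq> UNIV"
proof -
  obtain j :: nat where "j < 4" "i \<noteq> j" using that[of 0] that[of 1] by fastforce
  with \<zeta>_notin_line[OF assms] show ?thesis by blast
qed

section \<open>The sets of brackets with a fixed element\<close>

lemma exists_coord_pair: "\<exists>e\<in>hyperplane t. \<forall>i<4. coord_pair i e = v i"
proof
  let ?e = "\<lambda>k. if k < 4 then fst (v k) else if k < 8 then snd (v (k - 4))
    else if k = 8 then t * fst (v 3) else 0"
  show "?e \<in> hyperplane t" by (auto simp: hyperplane_def mem_Rn)
  show "\<forall>i<4. coord_pair i ?e = v i" by (auto simp: coord_pair_def)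
qed

lemma exists_prescribed_dets:
  "\<exists>q\<in>hyperplane t. \<forall>i<4. det2 (coord_pair i p) (coord_pair i q) = (if coord_pair i p = 0 then 0 else r i)"
proof -
  \<comment> \<open>The pair of \<open>p\<close> turned by a right angle and scaled by
    \<open>r i\<close> over its squared length. Where that pair vanishes, division by zero gives the
    pair 0.\<close>
  define v where "v i = (- p (4 + i) * r i / ((p i)\<^sup>2 + (p (4 + i))\<^sup>2),
    p i * r i / ((p i)\<^sup>2 + (p (4 + i))\<^sup>2))" for i
  have "det2 (coord_pair i p) (v i) = (if coord_pair i p = 0 then 0 else r i)" for i
  proof (cases "coord_pair i p = 0")
    case False
    then have ne: "(p i)\<^sup>2 + (p (4 + i))\<^sup>2 \<noteq> 0"
      by (simp add: coord_pair_def zero_prod_def sum_power2_eq_zero_iff)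
    have "det2 (coord_pair i p) (v i) = ((p i)\<^sup>2 + (p (4 + i))\<^sup>2) * r i / ((p i)\<^sup>2 + (p (4 + i))\<^sup>2)"
      by (simp add: coord_pair_def v_def power2_eq_square ring_distribs flip: add_divide_distrib)
    with ne False show ?thesis by simp
  qed (simp add: coord_pair_def zero_prod_def)
  moreover obtain q where "q \<in> hyperplane t" "\<forall>i<4. coord_pair i q = v i" using exists_coord_pair[of t v] by blast
  ultimately show ?thesis by (intro bexI[of _ q]) auto
qed

lemma center_bracket_single:
  assumes "i < 4" "\<And>k. k < 4 \<Longrightarrow> k \<noteq> i \<Longrightarrow> coord_pair k p = 0"
  shows "center_bracket t p q = det2 (coord_pair i p) (coord_pair i q) *\<^sub>R \<zeta> t i"
proof -
  have "center_bracket t p q = (\<Sum>k<4. if k = i then det2 (coord_pair k p) (coord_pair k q) *\<^sub>R \<zeta> t k else 0)"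
    unfolding center_bracket_def using assms(2) by (intro sum.cong) auto
  with assms(1) show ?thesis by simp
qed

lemma center_bracket_image_single:
  assumes "i < 4" "\<And>k. k < 4 \<Longrightarrow> k \<noteq> i \<Longrightarrow> coord_pair k p = 0" "coord_pair i p \<noteq> 0"
  shows "center_bracket t p ` hyperplane t = line t i"
proof (intro subset_antisym subsetI)
  fix z assume "z \<in> center_bracket t p ` hyperplane t"
  then show "z \<in> line t i" using center_bracket_single[OF assms(1,2)] by (auto simp: line_def)
next
  fix z assume "z \<in> line t i"
  then obtain r where z: "z = r *\<^sub>R \<zeta> t i" by (auto simp: line_def)
  obtain q where "q \<in> hyperplane t" "det2 (coord_pair i p) (coord_pair i q) = r"
    using exists_prescribed_dets[of t p "\<lambda>_. r"] assms(1,3) by auto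
  with z center_bracket_single[OF assms(1,2)] show "z \<in> center_bracket t p ` hyperplane t" by auto
qed

text \<open>The brackets with \<open>p\<close> detect which pairs of \<open>p\<close> are nonzero:
  each such pair contributes its own direction, since the determinants with the nonzero pairs can be
  prescribed independently.\<close>

lemma zeta_in_center_bracket_image:
  assumes "j < 4" "coord_pair j p \<noteq> 0"
  shows "\<zeta> t j \<in> center_bracket t p ` hyperplane t"
proof -
  obtain q where q: "q \<in> hyperplane t"
    "\<And>i. i < 4 \<Longrightarrow> det2 (coord_pair i p) (coord_pair i q) = (if coord_pair i p = 0 then 0 else if i = j then 1 else 0)"
    using exists_prescribed_dets[of t p "\<lambda>i. if i = j then 1 else 0"] by auto
  have "center_bracket t p q = (\<Sum>i<4. if i = j then \<zeta> t i else 0)"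
    unfolding center_bracket_def using q(2) assms by (intro sum.cong) auto
  with assms(1) have "center_bracket t p q = \<zeta> t j" by simp
  with q(1) show ?thesis by (metis imageI)
qed

lemma cramer_rule2:
  assumes "det2 u v \<noteq> 0"
  shows "z = (det2 z v / det2 u v) *\<^sub>R u + (det2 u z / det2 u v) *\<^sub>R v"
proof -
  have "det2 z v * fst u + det2 u z * fst v = det2 u v * fst z"
    "det2 z v * snd u + det2 u z * snd v = det2 u v * snd z" by algebra+
  then show ?thesis using assms
    by (intro prod_eqI) (simp_all del: right_diff_distrib left_diff_distrib flip: add_divide_distrib)
qed

text \<open>Two distinct directions span the plane; the prescribed determinants are the Cramer
  coefficients of \<open>z\<close>.\<close>

lemma center_bracket_image_two:
  assumes "t > 2" "i < 4" "j < 4" "i \<noteq> j" "coord_pair i p \<noteq> 0" "coord_pair j p \<noteq> 0"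
  shows "center_bracket t p ` hyperplane t = UNIV"
proof -
  have "z \<in> center_bracket t p ` hyperplane t" for z
  proof -
    define r where "r = (\<lambda>k. if k = i then det2 z (\<zeta> t j) / det2 (\<zeta> t i) (\<zeta> t j)
      else if k = j then det2 (\<zeta> t i) z / det2 (\<zeta> t i) (\<zeta> t j) else 0)"
    obtain q where q: "q \<in> hyperplane t"
      "\<And>k. k < 4 \<Longrightarrow> det2 (coord_pair k p) (coord_pair k q) = (if coord_pair k p = 0 then 0 else r k)"
      using exists_prescribed_dets[of t p r] by auto
    have "center_bracket t p q = (\<Sum>k<4. (if k = i then r i *\<^sub>R \<zeta> t i else 0) + (if k = j then r j *\<^sub>R \<zeta> t j else 0))"
      unfolding center_bracket_def by (intro sum.cong refl) (use q(2) assms in \<open>auto simp: r_def\<close>)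
    also have "\<dots> = r i *\<^sub>R \<zeta> t i + r j *\<^sub>R \<zeta> t j"
      using assms(2,3) by (simp add: sum.distrib)
    also have "\<dots> = z"
      using cramer_rule2[OF det_\<zeta>_nonzero[OF assms(1-4)], of z] assms(4) by (simp add: r_def)
    finally show ?thesis using q(1) by blast
  qed
  then show ?thesis by blast
qed

lemma center_bracket_surj:
  assumes "t > 2"
  shows "\<exists>p\<in>hyperplane t. \<exists>q\<in>hyperplane t. center_bracket t p q = z"
proof -
  obtain p where p: "p \<in> hyperplane t" "\<forall>i<4. coord_pair i p = (1, 0)" using exists_coord_pair[of t "\<lambda>_. (1, 0)"] by auto
  have "center_bracket t p ` hyperplane t = UNIV"
    by (rule center_bracket_image_two[OF assms, of 0 1]) (use p(2) in \<open>auto simp: zero_prod_def\<close>)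
  with p(1) show ?thesis by (metis UNIV_I imageE)
qed

text \<open>\<open>\<Phi>\<close> is the map induced on the centre. It permutes the four lines, is
  real-linear on each of them, and so transports the two linear relations among the
  \<open>\<zeta> s i\<close>, from which the cross ratio is recovered.\<close>

lemma center_rigidity:
  assumes gt: "s > 2" "t > 2"
    and \<phi>: "\<phi> ` hyperplane s = hyperplane t"
    and add: "\<And>x y. \<Phi> (x + y) = \<Phi> x + \<Phi> y" and bij: "bij \<Phi>"
    and equivariant: "\<And>p q. p \<in> hyperplane s \<Longrightarrow> q \<in> hyperplane s \<Longrightarrow> \<Phi> (center_bracket s p q) = center_bracket t (\<phi> p) (\<phi> q)"
  shows "s = t"
proof -
  have \<Phi>0: "\<Phi> 0 = 0" using add[of 0 0] by simp
  have inj: "\<Phi> x = \<Phi> y \<longleftrightarrow> x = y" for x y using bij by (meson bij_def inj_eq)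
  have image_K: "\<Phi> ` center_bracket s p ` hyperplane s = center_bracket t (\<phi> p) ` hyperplane t" if "p \<in> hyperplane s" for p
  proof -
    have "\<Phi> ` center_bracket s p ` hyperplane s = (\<lambda>q. center_bracket t (\<phi> p) (\<phi> q)) ` hyperplane s"
      unfolding image_image by (rule image_cong) (use equivariant that in auto)
    also have "\<dots> = center_bracket t (\<phi> p) ` hyperplane t" by (simp flip: \<phi> add: image_image)
    finally show ?thesis .
  qed
  have line_image: "\<exists>j<4. \<Phi> ` line s i = line t j" if i: "i < 4" for i
  proof -
    \<comment> \<open>The brackets with \<open>e\<close> fill exactly the line \<open>i\<close>.
      Hence \<open>\<phi> e\<close> must have exactly one nonzero pair: with none the line would
      collapse to 0, with two its image would be the whole plane.\<close>
    obtain e where e: "e \<in> hyperplane s" "\<And>k. k < 4 \<Longrightarrow> coord_pair k e = (if k = i then (1, 0) else 0)"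
      using exists_coord_pair[of s "\<lambda>k. if k = i then (1, 0) else 0"] by auto
    have l: "center_bracket s e ` hyperplane s = line s i"
      by (rule center_bracket_image_single) (use e(2) i in \<open>auto simp: zero_prod_def\<close>)
    note li = image_K[OF e(1), unfolded l]
    have "\<exists>j<4. coord_pair j (\<phi> e) \<noteq> 0"
    proof (rule ccontr)
      assume "\<not> (\<exists>j<4. coord_pair j (\<phi> e) \<noteq> 0)"
      then have "center_bracket t (\<phi> e) q = 0" for q by (auto simp: center_bracket_def intro!: sum.neutral)
      then have "\<Phi> ` line s i \<subseteq> {0}" using li by auto
      moreover have "\<zeta> s i \<in> line s i" unfolding line_def by (rule range_eqI[of _ _ 1]) simp
      ultimately have "\<Phi> (\<zeta> s i) = \<Phi> 0" using \<Phi>0 by auto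
      then show False using \<zeta>_nonzero inj by blast
    qed
    then obtain j where j: "j < 4" "coord_pair j (\<phi> e) \<noteq> 0" by blast
    have "coord_pair k (\<phi> e) = 0" if "k < 4" "k \<noteq> j" for k
    proof (rule ccontr)
      assume "coord_pair k (\<phi> e) \<noteq> 0"
      then have "\<Phi> ` line s i = UNIV"
        using center_bracket_image_two[OF gt(2) that(1) j(1) that(2) _ j(2)] li by simp
      then have "line s i = UNIV" using inj by (metis UNIV_eq_I UNIV_I imageE)
      then show False using line_ne_UNIV[OF gt(1) i] by blast
    qed
    then have "center_bracket t (\<phi> e) ` hyperplane t = line t j" using j by (intro center_bracket_image_single) auto
    with li j(1) show ?thesis by auto
  qed
  have "\<exists>j<4. \<exists>c. c \<noteq> 0 \<and> (\<forall>r. \<Phi> (r *\<^sub>R \<zeta> s i) = (c * r) *\<^sub>R \<zeta> t j)" if i: "i < 4" for i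
  proof -
    obtain j where j: "j < 4" and ij: "\<Phi> ` line s i = line t j" using line_image[OF i] by blast
    \<comment> \<open>Elements supported on pair \<open>i\<close> go to elements supported on pair
      \<open>j\<close>, since a further nonzero pair \<open>k\<close> would put
      \<open>\<zeta> t k\<close> on the line \<open>j\<close>.\<close>
    have supp: "coord_pair k (\<phi> p) = 0"
      if p: "p \<in> hyperplane s" "\<And>k. k < 4 \<Longrightarrow> k \<noteq> i \<Longrightarrow> coord_pair k p = 0" and k: "k < 4" "k \<noteq> j" for p k
    proof (rule ccontr)
      assume "coord_pair k (\<phi> p) \<noteq> 0"
      then have "\<zeta> t k \<in> center_bracket t (\<phi> p) ` hyperplane t" using k(1) by (rule zeta_in_center_bracket_image[rotated])
      also have "\<dots> = \<Phi> ` center_bracket s p ` hyperplane s" using image_K[OF p(1)] ..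
      also have "\<dots> \<subseteq> \<Phi> ` line s i" using center_bracket_single[OF i p(2)] by (auto simp: line_def)
      finally show False using \<zeta>_notin_line[OF gt(2) j k(1)] k(2) ij by auto
    qed
    have "\<exists>a. \<Phi> (r *\<^sub>R \<zeta> s i) = a *\<^sub>R \<zeta> t j" for r
      using ij unfolding line_def by blast
    then obtain \<alpha> where \<alpha>: "\<And>r. \<Phi> (r *\<^sub>R \<zeta> s i) = \<alpha> r *\<^sub>R \<zeta> t j" by metis
    \<comment> \<open>\<open>E u\<close> lifts the plane vector \<open>u\<close> to pair
      \<open>i\<close>. The bracket of two lifts is their determinant times
      \<open>\<zeta> s i\<close>, which supplies the area identity of
      \<open>additive_similitude_linear\<close>.\<close>
    have "\<exists>e\<in>hyperplane s. \<forall>k<4. coord_pair k e = (if k = i then u else 0)" for u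
      by (rule exists_coord_pair)
    then obtain E where E: "\<And>u. E u \<in> hyperplane s" "\<And>u k. k < 4 \<Longrightarrow> coord_pair k (E u) = (if k = i then u else 0)"
      by metis
    have lin: "\<alpha> r = \<alpha> 1 * r" for r
    proof (rule additive_similitude_linear[where h = "\<lambda>u. coord_pair j (\<phi> (E u))"])
      fix x y
      have "\<alpha> (x + y) *\<^sub>R \<zeta> t j = (\<alpha> x + \<alpha> y) *\<^sub>R \<zeta> t j"
        by (simp only: \<alpha>[symmetric] add scaleR_add_left)
      then show "\<alpha> (x + y) = \<alpha> x + \<alpha> y" by (simp only: scaleR_cancel_right \<zeta>_nonzero simp_thms)
    next
      have "\<Phi> (1 *\<^sub>R \<zeta> s i) \<noteq> \<Phi> 0" unfolding inj using \<zeta>_nonzero by simp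
      then show "\<alpha> 1 \<noteq> 0" unfolding \<alpha> \<Phi>0 by auto
    next
      fix u v
      have "center_bracket s (E u) (E v) = det2 u v *\<^sub>R \<zeta> s i"
        using E(2) i by (subst center_bracket_single[OF i]) auto
      then have "\<alpha> (det2 u v) *\<^sub>R \<zeta> t j = center_bracket t (\<phi> (E u)) (\<phi> (E v))"
        using equivariant[OF E(1) E(1), of u v] \<alpha> by simp
      also have "\<dots> = det2 (coord_pair j (\<phi> (E u))) (coord_pair j (\<phi> (E v))) *\<^sub>R \<zeta> t j"
        by (rule center_bracket_single[OF j], rule supp[OF E(1)]) (use E(2) in auto)
      finally show "\<alpha> (det2 u v) = det2 (coord_pair j (\<phi> (E u))) (coord_pair j (\<phi> (E v)))"
        by (simp only: scaleR_cancel_right \<zeta>_nonzero simp_thms)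
    qed
    have "\<Phi> (1 *\<^sub>R \<zeta> s i) \<noteq> \<Phi> 0" unfolding inj using \<zeta>_nonzero by simp
    then have "\<alpha> 1 \<noteq> 0" unfolding \<alpha> \<Phi>0 by auto
    with j \<alpha> lin show ?thesis by metis
  qed
  then obtain \<sigma> c where \<sigma>: "\<And>i. i < 4 \<Longrightarrow> \<sigma> i < (4::nat)" and c: "\<And>i. i < 4 \<Longrightarrow> c i \<noteq> 0"
    and \<Phi>: "\<And>i r. i < 4 \<Longrightarrow> \<Phi> (r *\<^sub>R \<zeta> s i) = (c i * r) *\<^sub>R \<zeta> t (\<sigma> i)"
    by metis
  have ne: "\<sigma> i \<noteq> \<sigma> k" if "i < 4" "k < 4" "i \<noteq> k" for i k
  proof
    assume "\<sigma> i = \<sigma> k"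
    \<comment> \<open>The multiples are crossed over so that both images have the same factor
      \<open>c i * c k\<close>.\<close>
    then have "\<Phi> (c k *\<^sub>R \<zeta> s i) = \<Phi> (c i *\<^sub>R \<zeta> s k)" by (simp add: \<Phi> that mult.commute)
    then have "c k *\<^sub>R \<zeta> s i = c i *\<^sub>R \<zeta> s k" by (simp only: inj)
    then have "(1 / c i) *\<^sub>R (c i *\<^sub>R \<zeta> s k) = (1 / c i) *\<^sub>R (c k *\<^sub>R \<zeta> s i)" by (simp only:)
    then have "\<zeta> s k = (c k / c i) *\<^sub>R \<zeta> s i" using c[OF that(1)] by simp
    then show False using \<zeta>_notin_line[OF gt(1) that] by (auto simp: line_def)
  qed
  \<comment> \<open>The parameter \<open>s\<close> enters here, as the coefficient that expresses
    the fourth direction by the first two. The factors 1 are written out so that the formula for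
    \<open>\<Phi>\<close> on multiples applies.\<close>
  have "\<zeta> s 2 = 1 *\<^sub>R \<zeta> s 0 + 1 *\<^sub>R \<zeta> s 1" "\<zeta> s 3 = 1 *\<^sub>R \<zeta> s 0 + s *\<^sub>R \<zeta> s 1"
    by (simp_all add: \<zeta>_def)
  then have "\<Phi> (1 *\<^sub>R \<zeta> s 2) = \<Phi> (1 *\<^sub>R \<zeta> s 0) + \<Phi> (1 *\<^sub>R \<zeta> s 1)"
    "\<Phi> (1 *\<^sub>R \<zeta> s 3) = \<Phi> (1 *\<^sub>R \<zeta> s 0) + \<Phi> (s *\<^sub>R \<zeta> s 1)"
    by (simp_all only: add[symmetric] scaleR_one)
  then have e: "c 2 *\<^sub>R \<zeta> t (\<sigma> 2) = c 0 *\<^sub>R \<zeta> t (\<sigma> 0) + c 1 *\<^sub>R \<zeta> t (\<sigma> 1)"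
    "c 3 *\<^sub>R \<zeta> t (\<sigma> 3) = c 0 *\<^sub>R \<zeta> t (\<sigma> 0) + (c 1 * s) *\<^sub>R \<zeta> t (\<sigma> 1)"
    by (simp_all add: \<Phi> del: scaleR_one One_nat_def)
  \<comment> \<open>Taking the determinant of the relation with \<open>z\<close> kills its left-hand
    side.\<close>
  have rel: "a * det2 x z + b * det2 y z = 0" if "d *\<^sub>R z = a *\<^sub>R x + b *\<^sub>R y" "d \<noteq> 0"
    for a b d :: real and x y z
  proof -
    have "d * fst z = a * fst x + b * fst y" "d * snd z = a * snd x + b * snd y"
      using arg_cong[OF that(1), of fst] arg_cong[OF that(1), of snd] by simp_all
    then show ?thesis by algebra
  qed
  have "c 0 * det2 (\<zeta> t (\<sigma> 0)) (\<zeta> t (\<sigma> 2)) + c 1 * det2 (\<zeta> t (\<sigma> 1)) (\<zeta> t (\<sigma> 2)) = 0"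
    "c 0 * det2 (\<zeta> t (\<sigma> 0)) (\<zeta> t (\<sigma> 3)) + (c 1 * s) * det2 (\<zeta> t (\<sigma> 1)) (\<zeta> t (\<sigma> 3)) = 0"
    using rel[OF e(1)] rel[OF e(2)] c by simp_all
  \<comment> \<open>Eliminating \<open>c 0\<close> from the two equations leaves the common factor
    \<open>c 1\<close>, which cancels.\<close>
  then have "c 1 * (det2 (\<zeta> t (\<sigma> 1)) (\<zeta> t (\<sigma> 2)) * det2 (\<zeta> t (\<sigma> 0)) (\<zeta> t (\<sigma> 3))) =
    c 1 * (s * (det2 (\<zeta> t (\<sigma> 1)) (\<zeta> t (\<sigma> 3)) * det2 (\<zeta> t (\<sigma> 0)) (\<zeta> t (\<sigma> 2))))"
    by algebra
  then have "det2 (\<zeta> t (\<sigma> 1)) (\<zeta> t (\<sigma> 2)) * det2 (\<zeta> t (\<sigma> 0)) (\<zeta> t (\<sigma> 3)) =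
    s * (det2 (\<zeta> t (\<sigma> 1)) (\<zeta> t (\<sigma> 3)) * det2 (\<zeta> t (\<sigma> 0)) (\<zeta> t (\<sigma> 2)))"
    using c[of 1] by simp
  then show ?thesis
    by (intro cross_ratio_rigid[OF gt, of "\<sigma> 0" "\<sigma> 1" "\<sigma> 2" "\<sigma> 3"] \<sigma> ne) auto
qed

section \<open>The hypersurface\<close>

lemma smooth_on_partial_deriv:
  assumes "smooth_on n U f" "i < n"
  shows "continuous_map (subtopology (Euclidean_space n) U) euclideanreal (partial_deriv i f)"
    and "x \<in> U \<Longrightarrow> ((\<lambda>r. f (x(i := r))) has_real_derivative partial_deriv i f x) (at (x i))"
proof -
  have "Ck_on n (Suc 0) U f" using assms(1) by (simp add: smooth_on_def del: Ck_on.simps)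
  then show "continuous_map (subtopology (Euclidean_space n) U) euclideanreal (partial_deriv i f)"
    "x \<in> U \<Longrightarrow> ((\<lambda>r. f (x(i := r))) has_real_derivative partial_deriv i f x) (at (x i))"
    using assms(2) by (auto simp: partial_deriv_def DERIV_deriv_iff_real_differentiable)
qed

text \<open>\<open>smooth_on\<close> speaks of iterated partial derivatives only. Total
  differentiability in the coordinates \<open>i\<close>, \<open>j\<close> comes from the partial
  derivative in \<open>i\<close> at \<open>p\<close> and the continuity of the one in
  \<open>j\<close>; then \<open>f\<close> is composed with the graph of \<open>g\<close>.\<close>

lemma chain_rule_graph:
  assumes smooth: "smooth_on n U f" and U: "openin (Euclidean_space n) U" "p \<in> U"
    and ij: "i < n" "j < n" "i \<noteq> j"
    and g: "(g has_real_derivative g') (at (p i))" "g (p i) = p j"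
  shows "((\<lambda>r. f (p(i := r, j := g r))) has_real_derivative
      partial_deriv i f p + g' * partial_deriv j f p) (at (p i))"
    and "\<forall>\<^sub>F r in at (p i). p(i := r, j := g r) \<in> U"
proof -
  have pR: "p \<in> Rn n" using U openin_subset by auto
  define P where "P = (\<lambda>z::real \<times> real. p(i := fst z, j := snd z))"
  have cont_P: "continuous_map euclidean (Euclidean_space n) P"
  proof -
    have "P = (\<lambda>z k. if k < n then P z k else 0)"
      using pR ij by (auto simp: P_def mem_Rn fun_eq_iff)
    moreover have "continuous_map euclidean euclideanreal (\<lambda>z. P z k)" for k
      by (cases "k = j"; cases "k = i") (auto simp: P_def intro!: continuous_intros)
    ultimately show ?thesis using continuous_map_componentwise_Euclidean_space[of _ n P] by simp
  qed
  define V where "V = {z. P z \<in> U}"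
  have "open V"
    using openin_continuous_map_preimage[OF cont_P U(1)] by (simp add: V_def)
  moreover have pV: "(p i, p j) \<in> V" using U(2) by (simp add: V_def P_def)
  ultimately obtain X Y where XY: "open X" "open Y" "p i \<in> X" "p j \<in> Y" "X \<times> Y \<subseteq> V"
    by (rule open_prod_elim) auto
  \<comment> \<open>The second factor is shrunk to a ball because
    \<open>has_derivative_partialsI\<close> requires it to be convex.\<close>
  obtain d where d: "d > 0" "ball (p j) d \<subseteq> Y" using XY(2,4) open_contains_ball by blast
  define Y' where "Y' = ball (p j) d"
  have Y': "open Y'" "p j \<in> Y'" "X \<times> Y' \<subseteq> V" "convex Y'"
    using d XY(5) by (auto simp: Y'_def)
  let ?D = "partial_deriv j f"
  have PV: "P ` V \<subseteq> U" by (auto simp: V_def)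
  have "continuous_map (subtopology euclidean V) (subtopology (Euclidean_space n) U) P"
    by (intro continuous_map_into_subtopology continuous_map_from_subtopology[OF cont_P])
       (use PV in auto)
  from continuous_map_compose[OF this smooth_on_partial_deriv(1)[OF smooth ij(2)]]
  have "continuous_on V (?D \<circ> P)" by simp
  then have DP: "continuous (at (p i, p j)) (?D \<circ> P)"
    using pV \<open>open V\<close> continuous_on_eq_continuous_at by blast
  have "((\<lambda>(x, y). f (P (x, y))) has_derivative
      (\<lambda>(tx, ty). partial_deriv i f p * tx + blinfun_mult_right (?D (P (p i, p j))) ty))
      (at (p i, p j) within X \<times> Y')"
  proof (rule has_derivative_partialsI[where fy = "\<lambda>x y. blinfun_mult_right (?D (P (x, y)))"])
    have e: "(\<lambda>x. f (P (x, p j))) = (\<lambda>x. f (p(i := x)))"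
      using ij by (auto simp: P_def intro!: ext arg_cong[of _ _ f])
    show "((\<lambda>x. f (P (x, p j))) has_derivative (*) (partial_deriv i f p)) (at (p i) within X)"
      using smooth_on_partial_deriv(2)[OF smooth ij(1) U(2)]
      unfolding e has_field_derivative_def by (rule has_derivative_at_withinI)
  next
    fix x y assume "x \<in> X" "y \<in> Y'"
    then have "P (x, y) \<in> U" using Y'(3) by (auto simp: V_def)
    from smooth_on_partial_deriv(2)[OF smooth ij(2) this]
    show "((\<lambda>y. f (P (x, y))) has_derivative blinfun_mult_right (?D (P (x, y)))) (at y within Y')"
      unfolding has_field_derivative_def by (auto simp: P_def intro: has_derivative_at_withinI)
  next
    have "continuous (at (p i, p j)) (\<lambda>z. blinfun_mult_right ((?D \<circ> P) z))"
      by (intro bounded_linear.continuous[OF bounded_linear_blinfun_mult_right] DP)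
    then show "continuous (at (p i, p j) within X \<times> Y') (\<lambda>(x, y). blinfun_mult_right (?D (P (x, y))))"
      by (auto simp: case_prod_unfold intro: continuous_at_imp_continuous_at_within)
  qed (use Y' in auto)
  moreover have "P (p i, p j) = p" by (simp add: P_def)
  moreover have "at (p i, p j) within X \<times> Y' = at (p i, p j)"
    using XY Y' by (intro at_within_open) (auto intro: open_Times)
  ultimately have F: "((\<lambda>z. f (P z)) has_derivative
      (\<lambda>z. partial_deriv i f p * fst z + ?D p * snd z)) (at (p i, g (p i)))"
    using g(2) by (simp add: case_prod_unfold)
  have G: "((\<lambda>r. (r, g r)) has_derivative (\<lambda>h. (h, g' * h))) (at (p i))"
    using g(1) by (auto simp: has_field_derivative_def intro!: derivative_eq_intros)
  have "((\<lambda>r. f (P (r, g r))) has_derivative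
      (\<lambda>h. partial_deriv i f p * h + ?D p * (g' * h))) (at (p i))"
    using has_derivative_compose[OF G F] by simp
  moreover have "(\<lambda>h. partial_deriv i f p * h + ?D p * (g' * h)) =
      (*) (partial_deriv i f p + g' * partial_deriv j f p)"
    by (auto simp: algebra_simps)
  ultimately show "((\<lambda>r. f (p(i := r, j := g r))) has_real_derivative
      partial_deriv i f p + g' * partial_deriv j f p) (at (p i))"
    unfolding has_field_derivative_def by (simp add: P_def)
  have "((\<lambda>r. (r, g r)) \<longlongrightarrow> (p i, p j)) (at (p i))"
    using g DERIV_isCont[OF g(1)] by (auto intro!: tendsto_Pair simp: isCont_def)
  from topological_tendstoD[OF this \<open>open V\<close> pV]
  show "\<forall>\<^sub>F r in at (p i). p(i := r, j := g r) \<in> U"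
    by (simp add: V_def P_def)
qed

definition hypersurface :: "point set" where
  "hypersurface = {x \<in> Rn 11. x 8 = (x 3)\<^sup>2 / 2}"

text \<open>Every defining function vanishes along curves inside the hypersurface: coordinate lines
  for \<open>i\<close> other than 3 and 8, the parabola for \<open>i = 3\<close>. This fixes the
  gradient up to the factor \<open>partial_deriv 8 f p\<close>, which is nonzero because the
  gradient is. Stating it for all \<open>f\<close> covers the one chosen by
  \<open>defining_fun\<close>.\<close>

lemma gradient_of_defining_near:
  assumes p: "p \<in> hypersurface" and f: "defining_near 11 hypersurface p U f"
  shows "i < 11 \<Longrightarrow> i \<noteq> 3 \<Longrightarrow> i \<noteq> 8 \<Longrightarrow> partial_deriv i f p = 0"
    and "partial_deriv 3 f p = - p 3 * partial_deriv 8 f p"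
    and "partial_deriv 8 f p \<noteq> 0"
proof -
  have U: "openin (Euclidean_space 11) U" "p \<in> U" and smooth: "smooth_on 11 U f"
    and zero: "\<And>x. x \<in> U \<Longrightarrow> x \<in> hypersurface \<Longrightarrow> f x = 0"
    using f by (auto simp: defining_near_def)
  have zero_deriv: "D = 0"
    if D: "((\<lambda>r. f (c r)) has_real_derivative D) (at a)"
      and c: "\<forall>\<^sub>F r in at a. c r \<in> U" "\<And>r. c r \<in> hypersurface" "c a = p" for c D a
  proof -
    have "\<forall>\<^sub>F r in at a. f (c r) = 0"
      using c(1) by eventually_elim (use c(2) zero in auto)
    moreover have "f (c a) = 0" using c(3) zero[OF U(2) p] by simp
    ultimately have "((\<lambda>r. 0) has_real_derivative D) (at a)"
      using D by (subst (asm) has_field_derivative_cong_eventually) auto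
    then show ?thesis using DERIV_unique DERIV_const by blast
  qed
  show other: "partial_deriv i f p = 0" if i: "i < 11" "i \<noteq> 3" "i \<noteq> 8" for i
  proof -
    \<comment> \<open>A coordinate line is the graph case with \<open>g\<close> constantly
      \<open>p 8\<close>.\<close>
    have "((\<lambda>_. p 8) has_real_derivative 0) (at (p i))" by simp
    note chain = chain_rule_graph[OF smooth U i(1) _ i(3) this, simplified]
    have "p(i := r, 8 := p 8) \<in> hypersurface" for r
      using p i by (auto simp: hypersurface_def mem_Rn)
    from zero_deriv[OF chain(1) chain(2) this] show ?thesis by simp
  qed
  have "((\<lambda>r. r\<^sup>2 / 2) has_real_derivative p 3) (at (p 3))"
    by (auto intro!: derivative_eq_intros)
  moreover have p8: "(p 3)\<^sup>2 / 2 = p 8" using p by (simp add: hypersurface_def)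
  ultimately have chain: "((\<lambda>r. f (p(3 := r, 8 := r\<^sup>2 / 2))) has_real_derivative
      partial_deriv 3 f p + p 3 * partial_deriv 8 f p) (at (p 3))"
    "\<forall>\<^sub>F r in at (p 3). p(3 := r, 8 := r\<^sup>2 / 2) \<in> U"
    using chain_rule_graph[OF smooth U, of 3 8 "\<lambda>r. r\<^sup>2 / 2" "p 3"] by simp_all
  have "p(3 := r, 8 := r\<^sup>2 / 2) \<in> hypersurface" for r
    using p by (auto simp: hypersurface_def mem_Rn)
  from zero_deriv[OF chain this] p8
  show three: "partial_deriv 3 f p = - p 3 * partial_deriv 8 f p" by simp
  show "partial_deriv 8 f p \<noteq> 0"
  proof
    assume "partial_deriv 8 f p = 0"
    then have "partial_deriv i f p = 0" if "i < 11" for i using other[OF that] three by auto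
    then show False using f p U(2) by (auto simp: defining_near_def)
  qed
qed

lemma exists_defining_near:
  assumes "p \<in> hypersurface"
  shows "\<exists>U f. defining_near 11 hypersurface p U f"
proof -
  let ?f = "\<lambda>x::point. x 8 - (1/2) * (x 3 * x 3)"
  have "defining_near 11 hypersurface p (Rn 11) ?f"
    unfolding defining_near_def
  proof (intro conjI ballI)
    show "smooth_on 11 (Rn 11) ?f"
      by (intro poly_map_smooth poly_map_diff poly_map.intros)
    show "\<exists>i<11. partial_deriv i ?f x \<noteq> 0" for x
    proof -
      have "partial_deriv 8 ?f x = 1"
        unfolding partial_deriv_def by (rule DERIV_imp_deriv) (auto intro!: derivative_eq_intros)
      then show ?thesis by (intro exI[of _ 8]) simp
    qed
    show "openin (Euclidean_space 11) (Rn 11)" by (rule openin_topspace)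
    show "p \<in> Rn 11" "hypersurface \<inter> Rn 11 = {x \<in> Rn 11. ?f x = 0}"
      using assms by (auto simp: hypersurface_def power2_eq_square)
  qed
  then show ?thesis by blast
qed

lemma smooth_hypersurface: "smooth_hypersurface 11 hypersurface"
proof -
  have "(\<lambda>_. 0) \<in> hypersurface" by (simp add: hypersurface_def mem_Rn)
  then show ?thesis
    by (auto simp: smooth_hypersurface_def exists_defining_near) (auto simp: hypersurface_def)
qed

lemma gradient_of_defining_fun:
  assumes "p \<in> hypersurface"
  shows "i < 11 \<Longrightarrow> i \<noteq> 3 \<Longrightarrow> i \<noteq> 8 \<Longrightarrow> partial_deriv i (defining_fun 11 hypersurface p) p = 0"
    and "partial_deriv 3 (defining_fun 11 hypersurface p) p =
      - p 3 * partial_deriv 8 (defining_fun 11 hypersurface p) p"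
    and "partial_deriv 8 (defining_fun 11 hypersurface p) p \<noteq> 0"
proof -
  have "\<exists>U. defining_near 11 hypersurface p U (defining_fun 11 hypersurface p)"
    unfolding defining_fun_def using someI_ex[of "\<lambda>f. \<exists>U. defining_near 11 hypersurface p U f"]
      exists_defining_near[OF assms] by blast
  then obtain U where "defining_near 11 hypersurface p U (defining_fun 11 hypersurface p)" ..
  note gradient_of_defining_near[OF assms this]
  then show "i < 11 \<Longrightarrow> i \<noteq> 3 \<Longrightarrow> i \<noteq> 8 \<Longrightarrow> partial_deriv i (defining_fun 11 hypersurface p) p = 0"
    and "partial_deriv 3 (defining_fun 11 hypersurface p) p =
      - p 3 * partial_deriv 8 (defining_fun 11 hypersurface p) p"
    and "partial_deriv 8 (defining_fun 11 hypersurface p) p \<noteq> 0"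
    by blast+
qed

section \<open>The Carnot group and its tangent groups\<close>

definition central :: "real \<times> real \<Rightarrow> point" where
  "central z = (\<lambda>k. if k = 9 then fst z else if k = 10 then snd z else 0)"

definition model_bracket :: "point \<Rightarrow> point \<Rightarrow> point" where
  "model_bracket p q = central (det2 (coord_pair 0 p) (coord_pair 0 q) + det2 (coord_pair 2 p) (coord_pair 2 q) + det2 (coord_pair 3 p) (coord_pair 3 q),
    det2 (coord_pair 1 p) (coord_pair 1 q) + det2 (coord_pair 2 p) (coord_pair 2 q) + det2 (p 8, p 7) (q 8, q 7))"

text \<open>The term in coordinates 8 and 7 is \<open>[a, y_3]\<close>. Substituting
  \<open>p 8 = t * p 3\<close> turns it into \<open>t\<close> times the determinant of pair 3, so
  this pair contributes in the direction \<open>(1, t)\<close>.\<close>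

lemma model_bracket_on_hyperplane:
  assumes "p \<in> hyperplane t" "q \<in> hyperplane t"
  shows "model_bracket p q = central (center_bracket t p q)"
  using assms
  by (simp add: model_bracket_def center_bracket_def hyperplane_def \<zeta>_def coord_pair_def eval_nat_numeral lessThan_Suc algebra_simps)

lemma poly_map_half:
  "poly_map (\<lambda>z. left_half n z k)" "poly_map (\<lambda>z. right_half n z k)"
  by (cases "k < n"; auto simp: left_half_def right_half_def intro: poly_map.intros)+

lemma central_unit: "central (1, 0) = unit_vec 9" "central (0, 1) = unit_vec 10"
  by (auto simp: central_def unit_vec_def)

interpretation step2_bracket 11 9 model_bracket
proof
  fix p q p' :: point and c :: real and k :: nat
  show "k < 9 \<or> 11 \<le> k \<Longrightarrow> model_bracket p q k = 0" by (auto simp: model_bracket_def central_def)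
  show "(\<And>k. k < 9 \<Longrightarrow> p k = 0) \<Longrightarrow> model_bracket p q k = 0" by (simp add: model_bracket_def central_def coord_pair_def)
  show "model_bracket (\<lambda>k. p k + p' k) q k = model_bracket p q k + model_bracket p' q k"
    by (simp add: model_bracket_def central_def coord_pair_def algebra_simps)
  show "model_bracket (scale_point c p) q k = c * model_bracket p q k"
    by (simp add: model_bracket_def central_def coord_pair_def scale_point_def algebra_simps)
  show "model_bracket q p k = - model_bracket p q k"
    by (simp add: model_bracket_def central_def coord_pair_def algebra_simps)
  show "poly_map (\<lambda>z. model_bracket (left_half 11 z) (right_half 11 z) k)"
    by (cases "k = 9"; cases "k = 10"; simp add: model_bracket_def central_def coord_pair_def;
        intro poly_map.intros poly_map_diff poly_map_half)
  \<comment> \<open>Pairs 0 and 1 already produce both unit vectors of the second layer.\<close>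
  have "model_bracket (unit_vec 0) (unit_vec 4) = central (1, 0)" "model_bracket (unit_vec 1) (unit_vec 5) = central (0, 1)"
    by (simp_all add: model_bracket_def coord_pair_def unit_vec_def)
  moreover have "\<forall>i\<ge>9. unit_vec 0 i = 0 \<and> unit_vec 4 i = 0"
    "\<forall>i\<ge>9. unit_vec 1 i = 0 \<and> unit_vec 5 i = 0"
    by (simp_all add: unit_vec_def)
  moreover assume "9 \<le> k" "k < 11"
  then have "k = 9 \<or> k = 10" by linarith
  ultimately show "\<exists>u v. (\<forall>i\<ge>9. u i = 0 \<and> v i = 0) \<and> model_bracket u v = unit_vec k"
    unfolding central_unit by blast
qed simp

section \<open>From abstract isomorphisms to maps of the centre\<close>

lemma central_in_hyperplane: "central z \<in> hyperplane t"
  by (auto simp: hyperplane_def central_def mem_Rn)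

lemma central_inject: "central x = central y \<longleftrightarrow> x = y"
proof
  assume "central x = central y"
  from fun_cong[OF this, of 9] fun_cong[OF this, of 10] show "x = y"
    by (simp add: central_def prod_eq_iff)
qed simp

lemma model_bracket_central [simp]: "model_bracket (central x) q k = 0" "model_bracket q (central x) k = 0"
  by (rule horizontal horizontal', simp add: central_def)+

lemma mult_central: "central x \<otimes>\<^bsub>G\<^esub> central y = central (x + y)"
proof -
  have "central x k + central y k = central (x + y) k" for k by (simp add: central_def)
  then show ?thesis by (simp add: fun_eq_iff)
qed

text \<open>Since the bracket is central, it is the group commutator. This writes it through
  multiplication alone, so abstract isomorphisms respect it.\<close>

lemma mult_commutator:
  "p \<otimes>\<^bsub>G\<^esub> q = (q \<otimes>\<^bsub>G\<^esub> p) \<otimes>\<^bsub>G\<^esub> model_bracket p q"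
proof -
  have "model_bracket r (model_bracket p q) k = 0" for r k by (rule horizontal') (simp add: vertical)
  then show ?thesis by (simp add: fun_eq_iff skew[of q p])
qed

lemma hyperplane_closed:
  assumes "p \<in> hyperplane t" "q \<in> hyperplane t"
  shows "p \<otimes>\<^bsub>G\<^esub> q \<in> hyperplane t"
  using assms vertical by (auto simp: hyperplane_def mem_Rn algebra_simps)

abbreviation "hyperplane_group t \<equiv> G\<lparr>carrier := hyperplane t\<rparr>"

lemma isomorphic_imp_eq:
  assumes gt: "s > 2" "t > 2" and iso: "hyperplane_group s \<cong> hyperplane_group t"
  shows "s = t"
proof -
  obtain h where bij: "bij_betw h (hyperplane s) (hyperplane t)"
    and hom: "\<And>p q. p \<in> hyperplane s \<Longrightarrow> q \<in> hyperplane s \<Longrightarrow> h (p \<otimes>\<^bsub>G\<^esub> q) = h p \<otimes>\<^bsub>G\<^esub> h q"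
    using iso by (auto simp: is_iso_def iso_def hom_def)
  have hW: "h p \<in> hyperplane t" if "p \<in> hyperplane s" for p using bij that by (auto simp: bij_betw_def)
  have h_inj: "h p = h q \<longleftrightarrow> p = q" if "p \<in> hyperplane s" "q \<in> hyperplane s" for p q
    using bij that by (auto simp: bij_betw_def inj_on_def)
  have B_W: "model_bracket p q \<in> hyperplane r" for p q r by (simp add: model_bracket_def central_in_hyperplane)
  have hB: "h (model_bracket p q) = model_bracket (h p) (h q)" if "p \<in> hyperplane s" "q \<in> hyperplane s" for p q
  proof -
    have "(h q \<otimes>\<^bsub>G\<^esub> h p) \<otimes>\<^bsub>G\<^esub> h (model_bracket p q) = h ((q \<otimes>\<^bsub>G\<^esub> p) \<otimes>\<^bsub>G\<^esub> model_bracket p q)"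
      by (simp only: hom that hyperplane_closed B_W)
    also have "\<dots> = h p \<otimes>\<^bsub>G\<^esub> h q"
      by (simp only: hom that flip: mult_commutator)
    also have "\<dots> = (h q \<otimes>\<^bsub>G\<^esub> h p) \<otimes>\<^bsub>G\<^esub> model_bracket (h p) (h q)"
      by (rule mult_commutator)
    finally have e: "(h q \<otimes>\<^bsub>G\<^esub> h p) \<otimes>\<^bsub>G\<^esub> h (model_bracket p q) = (h q \<otimes>\<^bsub>G\<^esub> h p) \<otimes>\<^bsub>G\<^esub> model_bracket (h p) (h q)" .
    \<comment> \<open>Cancellation is carried out in the ambient group, so that
      \<open>hyperplane t\<close> need not be shown to be a group.\<close>
    have R: "x \<in> hyperplane t \<Longrightarrow> x \<in> carrier G" for x by (simp add: hyperplane_def)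
    show ?thesis
      using e monoid.Units_l_cancel[OF group.is_monoid[OF group]] group.Units_eq[OF group]
        R[OF hyperplane_closed[OF hW hW]] R[OF hW] R[OF B_W] that B_W by metis
  qed
  \<comment> \<open>Every central vector is a single bracket, hence is mapped to a bracket, which is
    again central.\<close>
  have "\<exists>y. h (central z) = central y" for z
  proof -
    obtain p q where "p \<in> hyperplane s" "q \<in> hyperplane s" "center_bracket s p q = z" using center_bracket_surj[OF gt(1), of z] by blast
    then have "h (central z) = central (center_bracket t (h p) (h q))"
      using hB[of p q] model_bracket_on_hyperplane[of p s q] model_bracket_on_hyperplane[of "h p" t "h q"] by (simp add: hW)
    then show ?thesis ..
  qed
  then obtain \<Phi> where \<Phi>: "\<And>z. h (central z) = central (\<Phi> z)" by metis
  have \<Phi>center_bracket: "\<Phi> (center_bracket s p q) = center_bracket t (h p) (h q)" if "p \<in> hyperplane s" "q \<in> hyperplane s" for p q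
    using hB[OF that] model_bracket_on_hyperplane[OF that] model_bracket_on_hyperplane[OF hW hW, OF that] by (simp add: \<Phi> central_inject)
  show ?thesis
  proof (rule center_rigidity[OF gt, of h \<Phi>])
    show "h ` hyperplane s = hyperplane t" using bij by (simp add: bij_betw_def)
    show "\<Phi> (x + y) = \<Phi> x + \<Phi> y" for x y
    proof -
      have "central (\<Phi> (x + y)) = central (\<Phi> x) \<otimes>\<^bsub>G\<^esub> central (\<Phi> y)"
        by (simp only: \<Phi>[symmetric] mult_central[symmetric] hom central_in_hyperplane)
      then show ?thesis by (simp only: mult_central central_inject)
    qed
    have "inj \<Phi>"
    proof (rule injI)
      fix x y assume "\<Phi> x = \<Phi> y"
      then have "h (central x) = h (central y)" by (simp add: \<Phi>)
      then show "x = y" by (simp add: h_inj central_in_hyperplane central_inject)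
    qed
    moreover have "\<exists>x. z = \<Phi> x" for z
    proof -
      obtain p q where pq: "p \<in> hyperplane t" "q \<in> hyperplane t" "center_bracket t p q = z" using center_bracket_surj[OF gt(2), of z] by blast
      then obtain p' q' where "p' \<in> hyperplane s" "q' \<in> hyperplane s" "p = h p'" "q = h q'"
        using bij unfolding bij_betw_def by (metis imageE)
      with pq \<Phi>center_bracket show ?thesis by metis
    qed
    ultimately show "bij \<Phi>" unfolding bij_def surj_def by blast
  qed (rule \<Phi>center_bracket)
qed

text \<open>A horizontal field \<open>X_i\<close> differs from the coordinate derivative only in the
  components 9 and 10, where the gradient of the defining function vanishes.\<close>

lemma vf_apply_defining_fun:
  assumes p: "p \<in> hypersurface" and i: "i < 9"
  shows "vf_apply 11 (basis_field G i) (defining_fun 11 hypersurface p) p =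
    partial_deriv i (defining_fun 11 hypersurface p) p"
proof -
  let ?d = "\<lambda>k. partial_deriv k (defining_fun 11 hypersurface p) p"
  have "basis_field G i p k * ?d k = (if k = i then ?d k else 0)" if "k < 11" for k
    using gradient_of_defining_fun(1)[OF p, of k] that vertical[of k p "unit_vec i"]
    by (cases "k < 9") (auto simp: left_inv_field_eq unit_vec_def)
  then have "vf_apply 11 (basis_field G i) (defining_fun 11 hypersurface p) p =
      (\<Sum>k<11. if k = i then ?d k else 0)"
    unfolding vf_apply_def by (intro sum.cong) auto
  with i show ?thesis by simp
qed

lemma tangent_group_eq:
  assumes p: "p \<in> hypersurface"
  shows "tangent_group 11 degrees G hypersurface p = hyperplane_group (p 3)"
proof -
  let ?d = "\<lambda>k. partial_deriv k (defining_fun 11 hypersurface p) p"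
  have "(\<Sum>i<9::nat. v i * vf_apply 11 (basis_field G i) (defining_fun 11 hypersurface p) p) =
      (v 8 - p 3 * v 3) * ?d 8" for v :: point
  proof -
    have "(\<Sum>i<9::nat. v i * vf_apply 11 (basis_field G i) (defining_fun 11 hypersurface p) p) =
        (\<Sum>i<9::nat. (if i = 3 then v 3 * ?d 3 else 0) + (if i = 8 then v 8 * ?d 8 else 0))"
      by (intro sum.cong refl) (use gradient_of_defining_fun(1)[OF p] in
        \<open>auto simp: vf_apply_defining_fun[OF p]\<close>)
    also have "\<dots> = v 3 * ?d 3 + v 8 * ?d 8" by (simp add: sum.distrib)
    finally show ?thesis
      using gradient_of_defining_fun(2)[OF p] by (simp add: algebra_simps)
  qed
  then have "{v \<in> Rn 11. (\<Sum>i<9::nat. v i *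
      vf_apply 11 (basis_field G i) (defining_fun 11 hypersurface p) p) = 0} = hyperplane (p 3)"
    using gradient_of_defining_fun(3)[OF p] by (auto simp: hyperplane_def)
  then show ?thesis by (simp only: tangent_group_def horizontal_dim)
qed

lemma non_characteristic: "non_characteristic 11 degrees G hypersurface"
  unfolding non_characteristic_def
proof clarify
  fix p assume p: "p \<in> hypersurface"
    and sub: "horizontal_space 11 degrees G p \<subseteq> tangent_space 11 hypersurface p"
  \<comment> \<open>The field in the direction \<open>a\<close> is transversal everywhere: its
    derivative of the defining function is the eighth partial derivative, which never
    vanishes.\<close>
  have "basis_field G 8 p \<in> horizontal_space 11 degrees G p"
    unfolding horizontal_space_def lin_span_def horizontal_dim
    by (intro CollectI exI[of _ "{basis_field G 8 p}"] exI[of _ "\<lambda>_. 1"]) auto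
  with sub have "vf_apply 11 (basis_field G 8) (defining_fun 11 hypersurface p) p = 0"
    by (auto simp: tangent_space_def vf_apply_def)
  then show False
    using vf_apply_defining_fun[OF p, of 8] gradient_of_defining_fun(3)[OF p] by simp
qed

theorem proposition5p1:
  shows "\<exists>(n::nat) (s::nat) (w::nat \<Rightarrow> nat) (G::(nat \<Rightarrow> real) monoid) (S::(nat \<Rightarrow> real) set).
           carnot_group n s w G \<and> smooth_hypersurface n S \<and> non_characteristic n w G S \<and>
           (\<exists>P\<subseteq>S. uncountable P \<and>
              (\<forall>p\<in>P. \<forall>q\<in>P. p \<noteq> q \<longrightarrow>
                 \<not> tangent_group n w G S p \<cong> tangent_group n w G S q))"
proof -
  \<comment> \<open>A curve in the hypersurface with \<open>x_3 = t\<close>. Its parameter is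
    restricted to the interval from 2 to 3, which is uncountable and lies in the range
    \<open>t > 2\<close> where the cross ratio determines \<open>t\<close>.\<close>
  define \<gamma> :: "real \<Rightarrow> point" where
    "\<gamma> t = (\<lambda>k. if k = 3 then t else if k = 8 then t\<^sup>2 / 2 else 0)" for t
  have \<gamma>3: "\<gamma> t 3 = t" for t by (simp add: \<gamma>_def)
  have \<gamma>_mem: "\<gamma> t \<in> hypersurface" for t by (auto simp: \<gamma>_def hypersurface_def mem_Rn)
  have "inj_on \<gamma> {2<..<3}" by (rule inj_on_inverseI[of _ "\<lambda>p. p 3"]) (rule \<gamma>3)
  then have "uncountable (\<gamma> ` {2<..<3})"
    using uncountable_open_interval[of 2 3] countable_image_inj_on by force
  moreover have "\<not> tangent_group 11 degrees G hypersurface p \<cong> tangent_group 11 degrees G hypersurface q"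
    if "p \<in> \<gamma> ` {2<..<3}" "q \<in> \<gamma> ` {2<..<3}" "p \<noteq> q" for p q
  proof -
    from that(1,2) obtain s t where "p = \<gamma> s" "s > 2" "q = \<gamma> t" "t > 2" by auto
    with that(3) isomorphic_imp_eq[of s t] show ?thesis
      by (auto simp: tangent_group_eq \<gamma>_mem \<gamma>3)
  qed
  ultimately have "\<exists>P\<subseteq>hypersurface. uncountable P \<and> (\<forall>p\<in>P. \<forall>q\<in>P. p \<noteq> q \<longrightarrow>
      \<not> tangent_group 11 degrees G hypersurface p \<cong> tangent_group 11 degrees G hypersurface q)"
    using \<gamma>_mem by (intro exI[of _ "\<gamma> ` {2<..<3}"]) auto
  then show ?thesis
    using carnot smooth_hypersurface non_characteristic by blast
qed

end
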